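(* Let $\hat R_{VV}=\tau\circ R_0$, let $\hat R(z)=\tau\circ R(z)$ (with $R_0$, $R(z)$ as in the context), and put $$\lambda_1=(-1)^{\bar1}q^{-(-1)^{\bar1}},\qquad\lambda_2=-(-1)^{\bar1}q^{(-1)^{\bar1}},\qquad\lambda_3=q^{m-n-1}.$$ Then $R(z)$ coincides, up to $\tau$ and a rational function in $z$, with the Yang–Baxterization of $\hat R_{VV}$; specifically, $$\lambda_1(z-1)\hat R(z)=\lambda_1z(z-1)\hat R_{VV}^{-1}+\Big(1+\frac{\lambda_1}{\lambda_2}+\frac{\lambda_1}{\lambda_3}+\frac{\lambda_1^2}{\lambda_2\lambda_3}\Big)z\,\mathrm I-\frac{\lambda_1}{\lambda_2\lambda_3}(z-1)\hat R_{VV}\qquad\text{if }\bar1=1,$$ and $$\lambda_1(z-1)\hat R(z)=\lambda_1z(z-1)\hat R_{VV}^{-1}+\Big(1+\frac{\lambda_1}{\lambda_2}+\frac{\lambda_1}{\lambda_3}+\frac{\lambda_2}{\lambda_3}\Big)z\,\mathrm I-\frac1{\lambda_3}(z-1)\hat R_{VV}\qquad\text{if }\bar1=0.$$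
   Context: Fix integers $m,n\ge0$ with $n$ even, $N=m+n>2$, $s=\lfloor N/2\rfloor$, $i'=N+1-i$, $K=\mathbb C(q^{1/2})$. $V$ is a superspace over $K$ with homogeneous basis $v_1,\dots,v_N$, $m$ of them even and $n$ odd; $\bar i\in\{0,1\}$ is the parity of $v_i$, and $\bar i=\overline{i'}$. Fix $\vartheta_i\in\{\pm1\}$ with $\vartheta_i=1$ if $\bar i=0$, $\vartheta_i=-\vartheta_{i'}$ if $\bar i=1$. $E_{ij}$ are the matrix units, of parity $\bar i+\bar j$; tensor products of operators are graded: $(X\otimes Y)(v\otimes w)=(-1)^{|Y||v|}Xv\otimes Yw$. $\mathrm I$ is the identity, $\tau(v_i\otimes v_j)=(-1)^{\bar i\,\bar j}v_j\otimes v_i$, i.e. $\tau=\sum_{i,j}(-1)^{\bar j}E_{ij}\otimes E_{ji}$. $\varepsilon_1,\dots,\varepsilon_s$ are linearly independent with $(\varepsilon_i,\varepsilon_j)=\delta_{ij}(-1)^{\bar i}$; $\varepsilon_{i'}=-\varepsilon_i$, and $\varepsilon_{s+1}=0$ if $N$ is odd. $\Phi^+=\{\varepsilon_a-\varepsilon_b:a<b<a'\}\cup\{2\varepsilon_a:\bar a=1,a\le s\}$, where $\varepsilon_a-\varepsilon_b$ has parity $\bar a+\bar b$ and $2\varepsilon_a$ is even; $\rho$ is half the sum of the even positive roots minus half the sum of the odd positive roots. Put $$R_0=\mathrm I+(q^{-1/2}-q^{1/2})\sum_{i=1}^N(-1)^{\bar i}E_{ii}\otimes\Big(q^{-(\varepsilon_i,\varepsilon_i)/2}E_{ii}-q^{(\varepsilon_i,\varepsilon_i)/2}E_{i'i'}\Big)+(q^{-1}-q)\sum_{i<j}(-1)^{\bar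 j}E_{ij}\otimes\Big(E_{ji}-(-1)^{\bar j(\bar i+\bar j)}\vartheta_i\vartheta_jq^{(\rho,\varepsilon_i-\varepsilon_j)}E_{i'j'}\Big),$$ $$R_\infty=\mathrm I+(q^{1/2}-q^{-1/2})\sum_{i=1}^N(-1)^{\bar i}E_{ii}\otimes\Big(q^{(\varepsilon_i,\varepsilon_i)/2}E_{ii}-q^{-(\varepsilon_i,\varepsilon_i)/2}E_{i'i'}\Big)+(q-q^{-1})\sum_{i>j}(-1)^{\bar j}E_{ij}\otimes\Big(E_{ji}-(-1)^{\bar j(\bar i+\bar j)}\vartheta_i\vartheta_jq^{(\rho,\varepsilon_i-\varepsilon_j)}E_{i'j'}\Big),$$ $$R(z)=(z-q^{-m+n+2})R_\infty+(q-q^{-1})\frac{z-q^{-m+n+2}}{z-1}\tau-(q-q^{-1})q^{-m+n+2}\sum_{i,j=1}^N(-1)^{\bar i\,\bar j}\vartheta_i\vartheta_jq^{(\rho,\varepsilon_i-\varepsilon_j)}E_{ij}\otimes E_{i'j'}.$$ $\hat R_{VV}=\tau\circ R_0$ is the operator by which the universal $R$-matrix of $U_q(\mathfrak{osp}(V))$ intertwines $V\otimes V$ with itself; it is invertible. "The Yang–Baxterization" (of Ge–Wu–Xue) of an operator with eigenvalues $\lambda_1,\lambda_2,\lambda_3$ refers to the right-hand sides of the displayed identities. *)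

theory Defs
  imports
    "HOL-Analysis.Analysis"
    "HOL-Computational_Algebra.Computational_Algebra"
begin

text \<open>
  Conventions.  The basis vectors are numbered \<open>1, ..., N\<close>; \<open>p i\<close> (0 or 1) is the
  parity of \<open>v\<^sub>i\<close> and \<open>th i\<close> is its sign.  Only the values on \<open>{1..N}\<close> matter.
  The coordinates of \<open>V\<close> are indexed by a finite linearly ordered type with \<open>N\<close> elements, whose
  \<open>i\<close>-th smallest element is the label of \<open>v\<^sub>i\<close>; those of \<open>V \<otimes> V\<close> are indexed by pairs of labels.
  Operators are identified with their matrices, composition being \<open>**\<close>.
  All operators are defined over an arbitrary field containing a chosen square root \<open>h\<close> of \<open>q\<close>.
\<close>


section \<open>The scalars\<close>

type_synonym scalars = "complex poly fract"
  \<comment> \<open>the field of rational functions over \<open>\<complex>\<close> in the variable \<open>q\<close> to the power \<open>1/2\<close>\<close>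

type_synonym scalars_z = "scalars poly fract"
  \<comment> \<open>rational functions in the spectral parameter \<open>z\<close> with coefficients in \<^typ>\<open>scalars\<close>\<close>

definition sqrt_q :: scalars_z where
  "sqrt_q = to_fract [:to_fract [:0, 1:]:]"

definition z_var :: scalars_z where
  "z_var = to_fract [:0, 1:]"

definition qpow :: "'a::field \<Rightarrow> rat \<Rightarrow> 'a" where
  \<comment> \<open>\<open>q\<close> to the power \<open>r\<close>, where \<open>q = h\<^sup>2\<close>; used only if \<open>2 * r\<close> is an integer, so that the floor is exact\<close>
  "qpow h r = h powi \<lfloor>2 * r\<rfloor>"


section \<open>Weights and roots\<close>

definition mirror :: "nat \<Rightarrow> nat \<Rightarrow> nat" where
  "mirror N i = N + 1 - i"

type_synonym weight = "nat \<Rightarrow> rat"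
  \<comment> \<open>\<open>x\<close> stands for the combination of \<open>\<epsilon>\<^sub>1, ..., \<epsilon>\<^sub>s\<close> with coefficients \<open>x 1, ..., x s\<close>, \<open>s = N div 2\<close>\<close>

definition eps :: "nat \<Rightarrow> nat \<Rightarrow> weight" where
  "eps N i = (\<lambda>k. if i \<le> N div 2 then of_bool (k = i)
                  else if mirror N i \<le> N div 2 then - of_bool (k = mirror N i)
                  else 0)"

definition wform :: "nat \<Rightarrow> (nat \<Rightarrow> nat) \<Rightarrow> weight \<Rightarrow> weight \<Rightarrow> rat" where
  "wform N p x y = (\<Sum>k = 1..N div 2. (- 1) ^ p k * x k * y k)"

definition even_pos_roots :: "nat \<Rightarrow> (nat \<Rightarrow> nat) \<Rightarrow> weight set" where
  "even_pos_roots N p =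
     {eps N a - eps N b | a b. 1 \<le> a \<and> a < b \<and> b < mirror N a \<and> even (p a + p b)} \<union>
     {(\<lambda>k. 2 * eps N a k) | a. 1 \<le> a \<and> a \<le> N div 2 \<and> p a = 1}"

definition odd_pos_roots :: "nat \<Rightarrow> (nat \<Rightarrow> nat) \<Rightarrow> weight set" where
  "odd_pos_roots N p =
     {eps N a - eps N b | a b. 1 \<le> a \<and> a < b \<and> b < mirror N a \<and> odd (p a + p b)}"

definition rho :: "nat \<Rightarrow> (nat \<Rightarrow> nat) \<Rightarrow> weight" where
  "rho N p = (\<lambda>k. (\<Sum>\<alpha>\<in>even_pos_roots N p. \<alpha> k) / 2 - (\<Sum>\<alpha>\<in>odd_pos_roots N p. \<alpha> k) / 2)"


section \<open>Operators on the superspace and its tensor square\<close>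

type_synonym ('a, 'i) end_V = "(('a, 'i) vec, 'i) vec"
type_synonym ('a, 'i) end_VV = "(('a, 'i \<times> 'i) vec, 'i \<times> 'i) vec"

abbreviation scale_mat :: "'a::times \<Rightarrow> 'a^'n^'m \<Rightarrow> 'a^'n^'m" (infixr "\<odot>" 75) where
  "c \<odot> A \<equiv> map_matrix ((*) c) A"

definition basis_no :: "'i::{finite,linorder} \<Rightarrow> nat" where
  \<comment> \<open>the number in \<open>{1..N}\<close> of the basis vector labelled \<open>a\<close>\<close>
  "basis_no a = card {..a}"

definition Emat :: "nat \<Rightarrow> nat \<Rightarrow> ('a::zero_neq_one, 'i::{finite,linorder}) end_V" where
  "Emat i j = (\<chi> a b. of_bool (basis_no a = i \<and> basis_no b = j))"

definition gtensor ::
  "(nat \<Rightarrow> nat) \<Rightarrow> ('a::comm_ring_1, 'i::{finite,linorder}) end_V \<Rightarrow> ('a, 'i) end_V \<Rightarrow> ('a, 'i) end_VV"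
  where
  \<comment> \<open>The graded tensor product \<open>X \<otimes> Y\<close>.  The component of \<open>Y\<close> along \<open>E\<^sub>k\<^sub>l\<close> has parity \<open>p k + p l\<close>,
    which gives the sign with which it passes the first factor \<open>v\<^sub>j\<close> of \<open>v\<^sub>j \<otimes> v\<^sub>l\<close>.\<close>
  "gtensor p X Y =
     (\<chi> r c. (- 1) ^ ((p (basis_no (snd r)) + p (basis_no (snd c))) * p (basis_no (fst c)))
        * (X $ fst r $ fst c) * (Y $ snd r $ snd c))"

definition tau :: "(nat \<Rightarrow> nat) \<Rightarrow> ('a::comm_ring_1, 'i::{finite,linorder}) end_VV" where
  "tau p = (\<chi> r c. if r = (snd c, fst c) then (- 1) ^ (p (basis_no (fst c)) * p (basis_no (snd c))) else 0)"


section \<open>The R-matrices\<close>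

definition R_zero :: "nat \<Rightarrow> (nat \<Rightarrow> nat) \<Rightarrow> (nat \<Rightarrow> int) \<Rightarrow> 'a::field
    \<Rightarrow> ('a, 'i::{finite,linorder}) end_VV" where
  "R_zero N p th h =
     mat 1
     + (qpow h (- 1/2) - qpow h (1/2)) \<odot>
       (\<Sum>i = 1..N. (- 1) ^ p i \<odot>
          gtensor p (Emat i i)
            (qpow h (- wform N p (eps N i) (eps N i) / 2) \<odot> Emat i i
             - qpow h (wform N p (eps N i) (eps N i) / 2) \<odot> Emat (mirror N i) (mirror N i)))
     + (qpow h (- 1) - qpow h 1) \<odot>
       (\<Sum>i = 1..N. \<Sum>j = i + 1..N. (- 1) ^ p j \<odot>
          gtensor p (Emat i j)
            (Emat j i
             - ((- 1) ^ (p j * (p i + p j)) * of_int (th i) * of_int (th j)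
                * qpow h (wform N p (rho N p) (eps N i - eps N j))) \<odot>
               Emat (mirror N i) (mirror N j)))"

definition R_infinity :: "nat \<Rightarrow> (nat \<Rightarrow> nat) \<Rightarrow> (nat \<Rightarrow> int) \<Rightarrow> 'a::field
    \<Rightarrow> ('a, 'i::{finite,linorder}) end_VV" where
  "R_infinity N p th h =
     mat 1
     + (qpow h (1/2) - qpow h (- 1/2)) \<odot>
       (\<Sum>i = 1..N. (- 1) ^ p i \<odot>
          gtensor p (Emat i i)
            (qpow h (wform N p (eps N i) (eps N i) / 2) \<odot> Emat i i
             - qpow h (- wform N p (eps N i) (eps N i) / 2) \<odot> Emat (mirror N i) (mirror N i)))
     + (qpow h 1 - qpow h (- 1)) \<odot>
       (\<Sum>i = 1..N. \<Sum>j = 1..<i. (- 1) ^ p j \<odot>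
          gtensor p (Emat i j)
            (Emat j i
             - ((- 1) ^ (p j * (p i + p j)) * of_int (th i) * of_int (th j)
                * qpow h (wform N p (rho N p) (eps N i - eps N j))) \<odot>
               Emat (mirror N i) (mirror N j)))"

definition R_spec :: "nat \<Rightarrow> nat \<Rightarrow> (nat \<Rightarrow> nat) \<Rightarrow> (nat \<Rightarrow> int) \<Rightarrow> 'a::field \<Rightarrow> 'a
    \<Rightarrow> ('a, 'i::{finite,linorder}) end_VV" where
  "R_spec m n p th h z =
     (let N = m + n; c = qpow h (- of_nat m + of_nat n + 2) in
        (z - c) \<odot> R_infinity N p th h
        + ((qpow h 1 - qpow h (- 1)) * ((z - c) / (z - 1))) \<odot> tau p
        - ((qpow h 1 - qpow h (- 1)) * c) \<odot>
          (\<Sum>i = 1..N. \<Sum>j = 1..N.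
             ((- 1) ^ (p i * p j) * of_int (th i) * of_int (th j)
              * qpow h (wform N p (rho N p) (eps N i - eps N j))) \<odot>
             gtensor p (Emat i j) (Emat (mirror N i) (mirror N j))))"

definition R_hat_VV :: "nat \<Rightarrow> (nat \<Rightarrow> nat) \<Rightarrow> (nat \<Rightarrow> int) \<Rightarrow> 'a::field
    \<Rightarrow> ('a, 'i::{finite,linorder}) end_VV" where
  "R_hat_VV N p th h = tau p ** R_zero N p th h"

definition R_hat :: "nat \<Rightarrow> nat \<Rightarrow> (nat \<Rightarrow> nat) \<Rightarrow> (nat \<Rightarrow> int) \<Rightarrow> 'a::field \<Rightarrow> 'a
    \<Rightarrow> ('a, 'i::{finite,linorder}) end_VV" where
  "R_hat m n p th h z = tau p ** R_spec m n p th h z"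

end

theory Submission
  imports Defs
begin

text \<open>
  Write \<open>\<nu> = q - q\<^sup>-\<^sup>1\<close> and let \<open>Q\<close> be the double sum in \<open>R(z)\<close>.  Everything follows from two facts about
  \<open>R\<^sub>0\<close> and \<open>R\<^sub>\<infinity>\<close>:

    \<^item> \<open>(\<tau> R\<^sub>\<infinity>) (\<tau> R\<^sub>0) = 1\<close>, so that \<open>\<tau> R\<^sub>\<infinity>\<close> is the inverse of \<open>\<tau> R\<^sub>0\<close> (\<open>R_hat_VV_left_inverse\<close>);
    \<^item> the skein relation \<open>R\<^sub>\<infinity> - R\<^sub>0 = \<nu> (\<tau> - Q)\<close> (\<open>skein_entries\<close>).

  Since \<open>\<tau>\<^sup>2 = 1\<close>, the skein relation reads \<open>\<nu> \<tau> Q = \<nu> - (\<tau> R\<^sub>0)\<^sup>-\<^sup>1 + \<tau> R\<^sub>0\<close>.  Eliminating \<open>\<tau> Q\<close> from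
  \<open>\<tau> R(z) = (z - c) (\<tau> R\<^sub>0)\<^sup>-\<^sup>1 + \<nu> (z - c) / (z - 1) - \<nu> c \<tau> Q\<close>, where \<open>c = q\<close> to the power \<open>-m + n + 2\<close>,
  gives \<open>(z - 1) \<tau> R(z) = z (z - 1) (\<tau> R\<^sub>0)\<^sup>-\<^sup>1 + \<nu> (1 - c) z - c (z - 1) \<tau> R\<^sub>0\<close>
  (\<open>baxterization\<close>), and the two displayed identities are this one times \<open>\<lambda>\<^sub>1\<close>, with its
  coefficients expressed by the eigenvalues.

  The first fact is the substantial one.  Both operators preserve weights.  On the span of
  \<open>v\<^sub>a \<otimes> v\<^sub>b\<close> and \<open>v\<^sub>b \<otimes> v\<^sub>a\<close> with \<open>b \<noteq> a'\<close> the operator \<open>Q\<close> vanishes and the claim is a computation with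
  matrices of size at most two.  On the zero weight space, spanned by all \<open>v\<^sub>a \<otimes> v\<^sub>a\<^sub>'\<close>, every basis vector is coupled
  with every other one through \<open>Q\<close>.  After rescaling the basis, the entries of \<open>Q\<close> are signs, and the product of the
  two blocks reduces to the sums of \<open>(-1)\<close> to the parity of \<open>i\<close> times \<open>q\<close> to the power \<open>-2 (\<rho>, \<epsilon>\<^sub>i)\<close> over intervals of \<open>i\<close>
  (\<open>R_infinity_block_R_zero_block\<close>).  These telescope (\<open>weighted_geometric_sum\<close>), because
  \<open>2 (\<rho>, \<alpha>) = (\<alpha>, \<alpha>)\<close> for the simple roots \<open>\<alpha> = \<epsilon>\<^sub>r - \<epsilon>\<^sub>r\<^sub>+\<^sub>1\<close>.
\<close>

section \<open>The Weyl vector\<close>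

lemma image_pairs: "{f a b | a b. P a b} = (\<lambda>(a, b). f a b) ` {x. P (fst x) (snd x)}"
  by force

locale osp_data =
  fixes N :: nat and p :: "nat \<Rightarrow> nat" and th :: "nat \<Rightarrow> int" and h :: "'a::field"
  assumes parity: "i \<in> {1..N} \<Longrightarrow> p i \<in> {0, 1}"
    and parity_mirror: "i \<in> {1..N} \<Longrightarrow> p (mirror N i) = p i"
    and sign: "i \<in> {1..N} \<Longrightarrow> th i \<in> {1, -1}"
    and sign_even: "i \<in> {1..N} \<Longrightarrow> p i = 0 \<Longrightarrow> th i = 1"
    and sign_odd: "i \<in> {1..N} \<Longrightarrow> p i = 1 \<Longrightarrow> th i = - th (mirror N i)"
    and h_nonzero: "h \<noteq> 0"
begin

abbreviation mir :: "nat \<Rightarrow> nat" where "mir \<equiv> mirror N"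

definition sg :: "nat \<Rightarrow> int" where "sg i = (- 1) ^ p i"

definition inner_sum :: "nat \<Rightarrow> int" where
  "inner_sum a = (\<Sum>b \<in> {a<..<mir a}. sg b)"

lemma mir_mir [simp]: "i \<in> {1..N} \<Longrightarrow> mir (mir i) = i"
  by (auto simp: mirror_def)

lemma mir_in [simp]: "i \<in> {1..N} \<Longrightarrow> mir i \<in> {1..N}"
  by (auto simp: mirror_def)

lemma sg_mir [simp]: "i \<in> {1..N} \<Longrightarrow> sg (mir i) = sg i"
  by (simp add: sg_def parity_mirror)

lemma sg_cases: "i \<in> {1..N} \<Longrightarrow> sg i = 1 \<or> sg i = -1"
  using parity[of i] by (auto simp: sg_def)

text \<open>
  A self-mirrored index is even, because an odd one would have a sign opposite to itself.
\<close>

lemma parity_middle: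
  assumes "i \<in> {1..N}" "mir i = i" shows "p i = 0"
  using parity[OF assms(1)] sign[OF assms(1)] sign_odd[OF assms(1)] assms(2) by auto

lemma eps_mir: "i \<in> {1..N} \<Longrightarrow> eps N (mir i) = - eps N i"
  by (auto simp: eps_def mirror_def fun_eq_iff)

lemma eps_lower: "a \<le> N div 2 \<Longrightarrow> eps N a k = of_bool (k = a)"
  by (simp add: eps_def)

lemma eps_eq_0:
  assumes "k \<noteq> a" "k \<noteq> mir a" shows "eps N a k = 0"
  using assms by (auto simp: eps_def)

lemma eps_eq_1_iff: "eps N a k = 1 \<longleftrightarrow> a \<le> N div 2 \<and> k = a"
  by (simp add: eps_def)

lemma eps_eq_minus_1_iff:
  "eps N a k = - 1 \<longleftrightarrow> \<not> a \<le> N div 2 \<and> mir a \<le> N div 2 \<and> k = mir a"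
  by (simp add: eps_def)

lemma inj_eps: "inj_on (eps N) {1..N}"
proof (rule inj_onI)
  fix a b assume ab: "a \<in> {1..N}" "b \<in> {1..N}" and eq: "eps N a = eps N b"
  show "a = b"
  proof (cases "a \<le> N div 2 \<or> b \<le> N div 2")
    case True
    then show ?thesis using eq eps_eq_1_iff by metis
  next
    case False
    then have "mir a \<le> N div 2 \<longleftrightarrow> mir b \<le> N div 2" "mir a \<le> N div 2 \<Longrightarrow> mir a = mir b"
      using eq eps_eq_minus_1_iff by metis+
    then show ?thesis using False ab unfolding mirror_def by auto
  qed
qed

text \<open>
  The pairs \<open>(a, b)\<close> that index the positive roots \<open>\<epsilon>\<^sub>a - \<epsilon>\<^sub>b\<close>.  The root sets are sets of weights, so
  \<open>\<rho>\<close> is a sum over this index set only once different pairs are known to give different roots.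
\<close>

definition root_pairs :: "(nat \<times> nat) set" where
  "root_pairs = (SIGMA a:{1..N div 2}. {a<..<mir a})"

lemma root_pairs_iff: "(a, b) \<in> root_pairs \<longleftrightarrow> 1 \<le> a \<and> a < b \<and> b < mir a"
  by (auto simp: root_pairs_def mirror_def)

lemma finite_root_pairs: "finite root_pairs"
  by (simp add: root_pairs_def)

lemma inj_root: "inj_on (\<lambda>(a, b). eps N a - eps N b) root_pairs"
proof -
  have le: "c \<le> a" if ab: "(a, b) \<in> root_pairs" and cd: "(c, d) \<in> root_pairs"
    and eq: "eps N a - eps N b = eps N c - eps N d" for a b c d
  proof (rule ccontr)
    assume "\<not> c \<le> a"
    then have "a < c" by simp
    \<comment> \<open>The coefficient of \<open>\<epsilon>\<^sub>a\<close> separates the two roots.\<close>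
    have "a \<noteq> b" "a \<noteq> mir b" "a \<noteq> d" "a \<noteq> mir d" "a \<noteq> mir c" "a \<le> N div 2"
      using ab cd \<open>a < c\<close> by (auto simp: root_pairs_iff mirror_def)
    then have "eps N a a = 1" "eps N b a = 0" "eps N c a = 0" "eps N d a = 0"
      using \<open>a < c\<close> by (simp_all add: eps_lower eps_eq_0)
    then show False using fun_cong[OF eq, of a] by simp
  qed
  show ?thesis
  proof (rule inj_onI, clarsimp)
    fix a b c d assume ab: "(a, b) \<in> root_pairs" and cd: "(c, d) \<in> root_pairs"
      and eq: "eps N a - eps N b = eps N c - eps N d"
    have "a = c" using le[OF ab cd eq] le[OF cd ab eq[symmetric]] by simp
    moreover have "eps N b = eps N d" using eq \<open>a = c\<close> by (simp add: fun_eq_iff)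
    moreover have "b \<in> {1..N}" "d \<in> {1..N}" using ab cd by (auto simp: root_pairs_iff mirror_def)
    ultimately show "a = c \<and> b = d" using inj_onD[OF inj_eps] by blast
  qed
qed

text \<open>
  The terms of \<open>b\<close> and of its mirror image cancel.
\<close>

lemma sum_eps_inner:
  assumes "1 \<le> a"
  shows "(\<Sum>b \<in> {a<..<mir a}. of_int (sg b) * eps N b k) = 0"
proof -
  have "(\<Sum>b \<in> {a<..<mir a}. of_int (sg b) * eps N b k)
      = (\<Sum>b \<in> {a<..<mir a}. of_int (sg (mir b)) * eps N (mir b) k)"
    by (rule sum.reindex_bij_witness[of _ mir mir]) (use assms in \<open>auto simp: mirror_def\<close>)
  also have "\<dots> = (\<Sum>b \<in> {a<..<mir a}. - (of_int (sg b) * eps N b k))"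
  proof (rule sum.cong)
    fix b assume "b \<in> {a<..<mir a}"
    then have "b \<in> {1..N}" using assms by (auto simp: mirror_def)
    then show "of_int (sg (mir b)) * eps N (mir b) k = - (of_int (sg b) * eps N b k)"
      by (simp add: eps_mir)
  qed simp
  finally show ?thesis by (simp add: sum_negf)
qed

text \<open>
  Weighted with the product of the signs of \<open>a\<close> and \<open>b\<close>, the even and the odd roots \<open>\<epsilon>\<^sub>a - \<epsilon>\<^sub>b\<close> form a
  single sum over the pairs.  For fixed \<open>a\<close> the parts \<open>\<epsilon>\<^sub>b\<close> cancel by \<open>sum_eps_inner\<close>, which leaves
  \<open>inner_sum a\<close> times the sign of \<open>a\<close> as coefficient of \<open>\<epsilon>\<^sub>a\<close>; an odd \<open>a\<close> also contributes the root \<open>2 \<epsilon>\<^sub>a\<close>.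
\<close>

lemma rho_coeff:
  assumes k: "k \<in> {1..N div 2}"
  shows "rho N p k = of_int (sg k * inner_sum k + 1 - sg k) / 2"
proof -
  let ?r = "\<lambda>(a, b). eps N a - eps N b"
  let ?E = "{x \<in> root_pairs. even (p (fst x) + p (snd x))}"
  let ?O = "{x \<in> root_pairs. odd (p (fst x) + p (snd x))}"
  let ?D = "{a \<in> {1..N div 2}. p a = 1}"
  let ?d = "\<lambda>a k. 2 * eps N a k"
  have E: "even_pos_roots N p = ?r ` ?E \<union> ?d ` ?D"
  proof -
    have "{eps N a - eps N b | a b. 1 \<le> a \<and> a < b \<and> b < mir a \<and> even (p a + p b)} = ?r ` ?E"
      unfolding image_pairs by (rule arg_cong[where f="image _"]) (auto simp: root_pairs_iff)
    moreover have "{(\<lambda>k. 2 * eps N a k) | a. 1 \<le> a \<and> a \<le> N div 2 \<and> p a = 1} = ?d ` ?D"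
      unfolding image_Collect[symmetric] setcompr_eq_image by (rule arg_cong[where f="image _"]) auto
    ultimately show ?thesis unfolding even_pos_roots_def by simp
  qed
  have O: "odd_pos_roots N p = ?r ` ?O"
    unfolding odd_pos_roots_def image_pairs
    by (rule arg_cong[where f="image _"]) (auto simp: root_pairs_iff)
  have disj: "?r ` ?E \<inter> ?d ` ?D = {}"
  proof -
    have False if "(a, b) \<in> root_pairs" "c \<in> ?D" "eps N a - eps N b = ?d c" for a b c
      using fun_cong[OF that(3), of c] that(1,2)
      by (auto simp: eps_def root_pairs_iff mirror_def of_bool_def split: if_splits)
    then show ?thesis by fastforce
  qed
  have injd: "inj_on ?d ?D"
  proof (rule inj_onI)
    fix x y assume "x \<in> ?D" "y \<in> ?D" "?d x = ?d y"
    then show "x = y" using fun_cong[of "?d x" "?d y" x] by (auto simp: eps_def split: if_splits)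
  qed
  have fin: "finite ?E" "finite ?O" using finite_root_pairs by simp_all
  have inj: "inj_on ?r ?E" "inj_on ?r ?O" by (rule inj_on_subset[OF inj_root]; blast)+
  have "(\<Sum>\<alpha>\<in>even_pos_roots N p. \<alpha> k) = (\<Sum>\<alpha>\<in>?r ` ?E. \<alpha> k) + (\<Sum>\<alpha>\<in>?d ` ?D. \<alpha> k)"
    unfolding E by (rule sum.union_disjoint) (use fin disj in simp_all)
  also have "(\<Sum>\<alpha>\<in>?r ` ?E. \<alpha> k) = (\<Sum>x\<in>?E. ?r x k)"
    by (simp only: sum.reindex[OF inj(1)] o_def)
  also have "(\<Sum>\<alpha>\<in>?d ` ?D. \<alpha> k) = (\<Sum>a\<in>?D. ?d a k)"
    by (simp only: sum.reindex[OF injd] o_def)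
  finally have "(\<Sum>\<alpha>\<in>even_pos_roots N p. \<alpha> k) - (\<Sum>\<alpha>\<in>odd_pos_roots N p. \<alpha> k)
      = (\<Sum>x\<in>?E. ?r x k) - (\<Sum>x\<in>?O. ?r x k) + (\<Sum>a\<in>?D. ?d a k)"
    unfolding O by (simp only: sum.reindex[OF inj(2)] o_def)
  also have "(\<Sum>x\<in>?E. ?r x k) - (\<Sum>x\<in>?O. ?r x k)
      = (\<Sum>x\<in>root_pairs. of_int (sg (fst x) * sg (snd x)) * ?r x k)"
  proof -
    have "(\<Sum>x\<in>root_pairs. of_int (sg (fst x) * sg (snd x)) * ?r x k)
      = (\<Sum>x\<in>?E. of_int (sg (fst x) * sg (snd x)) * ?r x k)
        + (\<Sum>x\<in>?O. of_int (sg (fst x) * sg (snd x)) * ?r x k)"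
      by (subst sum.union_disjoint[symmetric]) (auto simp: finite_root_pairs intro!: sum.cong)
    moreover have "(\<Sum>x\<in>?E. of_int (sg (fst x) * sg (snd x)) * ?r x k) = (\<Sum>x\<in>?E. ?r x k)"
      by (rule sum.cong) (auto simp: sg_def simp flip: power_add)
    moreover have "(\<Sum>x\<in>?O. of_int (sg (fst x) * sg (snd x)) * ?r x k) = (\<Sum>x\<in>?O. - ?r x k)"
      by (rule sum.cong) (auto simp: sg_def simp flip: power_add)
    ultimately show ?thesis by (simp add: sum_negf)
  qed
  also have "(\<Sum>x\<in>root_pairs. of_int (sg (fst x) * sg (snd x)) * ?r x k)
     = (\<Sum>a = 1..N div 2. of_int (sg a) * (\<Sum>b\<in>{a<..<mir a}. of_int (sg b) * eps N a k - of_int (sg b) * eps N b k))"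
    unfolding root_pairs_def
    by (simp add: sum.Sigma case_prod_unfold sum_distrib_left algebra_simps)
  also have "\<dots> = (\<Sum>a = 1..N div 2. of_bool (a = k) * (of_int (sg a * inner_sum a)))"
    by (rule sum.cong) (auto simp: sum_subtractf sum_eps_inner inner_sum_def eps_lower simp flip: sum_distrib_right)
  also have "\<dots> = of_int (sg k * inner_sum k)"
    using k by (simp add: of_bool_def if_distrib[of "\<lambda>x. x * _"] cong: if_cong)
  also have "(\<Sum>a\<in>?D. ?d a k) = of_int (1 - sg k)"
  proof -
    have "(\<Sum>a\<in>?D. ?d a k) = (\<Sum>a\<in>?D. if a = k then 2 else 0)"
      by (rule sum.cong) (auto simp: eps_lower)
    also have "\<dots> = of_int (1 - sg k)" using k parity[of k] by (auto simp: sg_def)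
    finally show ?thesis .
  qed
  finally show ?thesis unfolding rho_def by (simp add: diff_divide_distrib[symmetric])
qed

text \<open>
  The integers \<open>nrm i = (\<epsilon>\<^sub>i, \<epsilon>\<^sub>i)\<close> and \<open>rho2 i = 2 (\<rho>, \<epsilon>\<^sub>i)\<close>; they serve as exponents of \<open>q\<close>.
\<close>

definition nrm :: "nat \<Rightarrow> int" where "nrm i = (if mir i = i then 0 else sg i)"

definition rho2 :: "nat \<Rightarrow> int" where
  "rho2 i = (if i \<le> N div 2 then inner_sum i + sg i - 1
          else if mir i \<le> N div 2 then - (inner_sum (mir i) + sg i - 1) else 0)"

lemma middle_iff: "i \<in> {1..N} \<Longrightarrow> mir i = i \<longleftrightarrow> \<not> i \<le> N div 2 \<and> \<not> mir i \<le> N div 2"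
  unfolding mirror_def by auto

lemma upper_half: "i \<in> {1..N} \<Longrightarrow> i \<le> N div 2 \<Longrightarrow> \<not> mir i \<le> N div 2"
  unfolding mirror_def by auto

lemma nrm_mir [simp]: "i \<in> {1..N} \<Longrightarrow> nrm (mir i) = nrm i"
  by (auto simp: nrm_def)

lemma rho2_mir [simp]: "i \<in> {1..N} \<Longrightarrow> rho2 (mir i) = - rho2 i"
  using upper_half[of i] by (auto simp: rho2_def)

lemma wform_eps:
  assumes "i \<in> {1..N}"
  shows "wform N p x (eps N i) =
    (if i \<le> N div 2 then of_int (sg i) * x i
     else if mir i \<le> N div 2 then - of_int (sg i) * x (mir i) else 0)"
proof -
  have *: "wform N p x (eps N j) = of_int (sg j) * x j" if "j \<in> {1..N}" "j \<le> N div 2" for j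
  proof -
    have "wform N p x (eps N j) = (\<Sum>k = 1..N div 2. if k = j then (- 1) ^ p j * x j else 0)"
      unfolding wform_def by (rule sum.cong) (use that in \<open>auto simp: eps_lower\<close>)
    then show ?thesis using that by (simp add: sg_def)
  qed
  have neg: "wform N p x (eps N i) = - wform N p x (eps N (mir i))"
    using eps_mir[OF assms] by (simp add: wform_def sum_negf)
  have zero: "wform N p x (eps N i) = 0" if "\<not> i \<le> N div 2" "\<not> mir i \<le> N div 2"
    using that by (simp add: wform_def eps_def)
  show ?thesis
    using *[of i] *[of "mir i"] neg zero assms mir_in[OF assms] sg_mir[OF assms] by auto
qed

lemma wform_eps_eps: "i \<in> {1..N} \<Longrightarrow> wform N p (eps N i) (eps N i) = of_int (nrm i)"
  unfolding wform_eps using middle_iff[of i] upper_half[of i]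
  by (auto simp: nrm_def of_bool_def eps_def[of N i])

lemma wform_rho_eps:
  assumes "i \<in> {1..N}"
  shows "wform N p (rho N p) (eps N i) = of_int (rho2 i) / 2"
proof -
  have *: "of_int (sg j) * rho N p j = of_int (inner_sum j + sg j - 1) / 2"
    if "j \<in> {1..N div 2}" for j
  proof -
    have "j \<in> {1..N}" using that by auto
    from sg_cases[OF this] show ?thesis using rho_coeff[OF that] by auto
  qed
  show ?thesis
    using *[of i] *[of "mir i"] assms mir_in[OF assms]
    by (auto simp: wform_eps rho2_def)
qed

lemma wform_rho_diff:
  assumes "i \<in> {1..N}" "j \<in> {1..N}"
  shows "wform N p (rho N p) (eps N i - eps N j) = of_int (rho2 i - rho2 j) / 2"
proof -
  have "wform N p (rho N p) (eps N i - eps N j) =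
      wform N p (rho N p) (eps N i) - wform N p (rho N p) (eps N j)"
    by (simp add: wform_def algebra_simps sum_subtractf)
  then show ?thesis using assms by (simp add: wform_rho_eps diff_divide_distrib)
qed

text \<open>
  Passing from \<open>r\<close> to \<open>r + 1\<close> removes \<open>r + 1\<close> and its mirror image from the interval that defines
  \<open>inner_sum\<close>, so its value drops by twice the sign of \<open>r + 1\<close>; if \<open>r + 1\<close> is the middle index, which is
  even, the interval is that single point.
\<close>

lemma rho2_step_lower:
  assumes r: "1 \<le> r" "r \<le> N div 2" "Suc r \<noteq> mir r"
  shows "rho2 r - rho2 (Suc r) = nrm r + nrm (Suc r)"
proof (cases "Suc r \<le> N div 2")
  case True
  have set: "{r<..<mir r} = insert (Suc r) (insert (mir (Suc r)) {Suc r<..<mir (Suc r)})"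
    using True r by (auto simp: mirror_def)
  have "inner_sum r = inner_sum (Suc r) + 2 * sg (Suc r)"
    unfolding inner_sum_def set using True r sg_mir[of "Suc r"] by (auto simp: mirror_def)
  moreover have "mir r \<noteq> r" "mir (Suc r) \<noteq> Suc r" using True by (auto simp: mirror_def)
  ultimately show ?thesis using True r by (simp add: rho2_def nrm_def)
next
  case False
  then have mid: "mir (Suc r) = Suc r" and set: "{r<..<mir r} = {Suc r}"
    using r by (auto simp: mirror_def)
  moreover have "sg (Suc r) = 1"
    using parity_middle[of "Suc r"] mid by (simp add: sg_def mirror_def)
  moreover have "mir r \<noteq> r" using r by (auto simp: mirror_def)
  ultimately show ?thesis using r False by (simp add: rho2_def nrm_def inner_sum_def)
qed

text \<open>
  This is \<open>2 (\<rho>, \<alpha>) = (\<alpha>, \<alpha>)\<close> for the simple root \<open>\<alpha> = \<epsilon>\<^sub>r - \<epsilon>\<^sub>r\<^sub>+\<^sub>1\<close>.  Above the middle the same roots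
  appear again, as \<open>\<epsilon>\<^sub>r - \<epsilon>\<^sub>r\<^sub>+\<^sub>1\<close> does not change when both indices are mirrored and exchanged.
\<close>

lemma rho2_step:
  assumes r: "1 \<le> r" "r < N" "Suc r \<noteq> mir r"
  shows "rho2 r - rho2 (Suc r) = nrm r + nrm (Suc r)"
proof (cases "r \<le> N div 2")
  case True
  then show ?thesis using rho2_step_lower r by simp
next
  case False
  define r' where "r' = N - r"
  have r': "1 \<le> r'" "r' \<le> N div 2" "Suc r' \<noteq> mir r'"
    and m: "r = mir (Suc r')" "Suc r = mir r'" "r' \<in> {1..N}" "Suc r' \<in> {1..N}"
    using r False by (auto simp: r'_def mirror_def)
  have "rho2 r = - rho2 (Suc r')" "nrm r = nrm (Suc r')" "rho2 (Suc r) = - rho2 r'" "nrm (Suc r) = nrm r'"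
    using m rho2_mir nrm_mir by metis+
  then show ?thesis using rho2_step_lower[OF r'] by simp
qed

lemma rho2_step_centre:
  assumes r: "1 \<le> r" "Suc r = mir r"
  shows "rho2 r = sg r - 1" "rho2 (Suc r) = 1 - sg r" "nrm r = sg r" "nrm (Suc r) = sg r"
proof -
  have "r \<in> {1..N}" using r by (auto simp: mirror_def)
  moreover have "{r<..<mir r} = {}" using r(2)[symmetric] by auto
  then have "inner_sum r = 0" by (simp only: inner_sum_def sum.empty)
  moreover have "r \<le> N div 2" using r by (simp add: mirror_def)
  ultimately have *: "rho2 r = sg r - 1" "nrm r = sg r" using r by (simp_all add: rho2_def nrm_def)
  moreover have "rho2 (Suc r) = - rho2 r" "nrm (Suc r) = nrm r"
    unfolding r(2) using \<open>r \<in> {1..N}\<close> by simp_all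
  ultimately show "rho2 r = sg r - 1" "rho2 (Suc r) = 1 - sg r" "nrm r = sg r" "nrm (Suc r) = sg r"
    by simp_all
qed

section \<open>The telescoping sum\<close>

definition q :: 'a where "q = h\<^sup>2"
definition nu :: 'a where "nu = q - inverse q"

lemma q_nonzero [simp]: "q \<noteq> 0" using h_nonzero by (simp add: q_def)

lemma nu_sg:
  assumes "i \<in> {1..N}" "mir i \<noteq> i"
  shows "nu * of_int (sg i) = q powi nrm i - q powi (- nrm i)"
  using sg_cases[OF assms(1)] assms(2) by (auto simp: nu_def nrm_def power_int_minus)

text \<open>
  The multiplicative form of \<open>rho2_step\<close>.  The step across the centre for even \<open>N\<close>, where
  \<open>\<epsilon>\<^sub>r - \<epsilon>\<^sub>r\<^sub>+\<^sub>1 = 2 \<epsilon>\<^sub>r\<close>, is the only one with a defect, and the defect is \<open>\<nu>\<close> for either parity of \<open>r\<close>.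
\<close>

lemma q_power_step:
  assumes r: "1 \<le> r" "r < N"
  shows "q powi (nrm r - rho2 r) = q powi (- nrm (Suc r) - rho2 (Suc r)) + nu * of_bool (Suc r = mir r)"
proof (cases "Suc r = mir r")
  case True
  note * = rho2_step_centre[OF r(1) True]
  have "sg r = 1 \<or> sg r = -1" using r by (intro sg_cases) auto
  then show ?thesis using True unfolding * by (auto simp: nu_def power_int_minus)
next
  case False
  from rho2_step[OF r False] have "nrm r - rho2 r = - nrm (Suc r) - rho2 (Suc r)" by simp
  with False show ?thesis by simp
qed

text \<open>
  By \<open>nu_sg\<close>, \<open>\<nu>\<close> times a summand other than the middle one is a difference of two powers of \<open>q\<close>, and by \<open>q_power_step\<close> the second of them
  cancels against the first one of its predecessor.  The final term collects the defects: one \<open>\<nu>\<close> is picked up as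
  soon as the endpoints lie strictly on different sides of the centre, from the central step if \<open>N\<close> is
  even and from the middle index, whose summand is \<open>1\<close>, if \<open>N\<close> is odd.
\<close>

lemma weighted_geometric_sum:
  assumes l: "1 \<le> l" and r: "l < r" "r \<le> N"
  shows "nu * (\<Sum>i\<in>{l<..<r}. of_int (sg i) * q powi (- rho2 i))
    = q powi (- nrm r - rho2 r) - q powi (nrm l - rho2 l) + nu * of_bool (l < mir l \<and> mir r < r)"
  using Suc_leI[OF r(1)] r(2)
proof (induction r rule: dec_induct)
  case base
  have "{l<..<Suc l} = {}" by auto
  moreover have "(l < mir l \<and> mir (Suc l) < Suc l) = (Suc l = mir l)"
    using l by (auto simp: mirror_def)
  ultimately show ?case using q_power_step[of l] l base by simp
next
  case (step r)
  have set: "{l<..<Suc r} = insert r {l<..<r}" using step by auto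
  have r: "r \<in> {1..N}" using step l by auto
  have "nu * (of_int (sg r) * q powi (- rho2 r)) = q powi (nrm r - rho2 r) - q powi (- nrm r - rho2 r)
      + nu * of_bool (mir r = r)"
  proof (cases "mir r = r")
    case True
    moreover have "sg r = 1" "rho2 r = 0" "nrm r = 0"
      using parity_middle[OF r True] middle_iff[OF r] True by (simp_all add: sg_def rho2_def nrm_def)
    ultimately show ?thesis by simp
  next
    case False
    then show ?thesis
      unfolding mult.assoc[symmetric] nu_sg[OF r False]
      by (simp add: left_diff_distrib flip: power_int_add)
  qed
  moreover have "(of_bool (l < mir l \<and> mir (Suc r) < Suc r) :: 'a)
     = of_bool (l < mir l \<and> mir r < r) + of_bool (mir r = r) + of_bool (Suc r = mir r)"
    using step l by (auto simp: mirror_def of_bool_def)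
  ultimately show ?case
    using step.IH step.hyps step.prems q_power_step[of r] l unfolding set
    by (simp add: distrib_left split del: split_of_bool)
qed

section \<open>The zero weight space\<close>

text \<open>
  The matrices of \<open>\<tau> R\<^sub>\<infinity>\<close> and \<open>\<tau> R\<^sub>0\<close> on the zero weight space, in the basis of the vectors
  \<open>v\<^sub>a \<otimes> v\<^sub>a\<^sub>'\<close> multiplied by \<open>\<vartheta>\<^sub>a\<close> and by \<open>q\<close> to the power \<open>(\<rho>, \<epsilon>\<^sub>a)\<close>.  This scaling cancels
  the factor \<open>\<vartheta>\<^sub>i \<vartheta>\<^sub>j\<close> times \<open>q\<close> to the power \<open>(\<rho>, \<epsilon>\<^sub>i - \<epsilon>\<^sub>j)\<close> in \<open>Q\<close>.
\<close>

definition R_infinity_block :: "nat \<Rightarrow> nat \<Rightarrow> 'a" where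
  "R_infinity_block k j = q powi (rho2 j - nrm j) * of_bool (k = mir j)
    + nu * (of_bool (j < mir j \<and> k = j) - of_int (sg j) * q powi (- rho2 k) * of_bool (j < mir k))"

definition R_zero_block :: "nat \<Rightarrow> nat \<Rightarrow> 'a" where
  "R_zero_block k j = q powi (nrm j + rho2 j) * of_bool (k = mir j)
    - nu * (of_bool (mir j < j \<and> k = j) - of_int (sg j) * q powi (- rho2 k) * of_bool (mir k < j))"

text \<open>
  The \<open>\<nu>\<close> that \<open>weighted_geometric_sum\<close> picks up across the centre merges with the diagonal entries of
  the block into the last term.
\<close>

lemma R_infinity_block_tail_sum:
  assumes k: "k \<in> {1..N}" and l: "l \<in> {1..N}"
  shows "(\<Sum>i\<in>{l<..N}. q powi (- rho2 i) * R_infinity_block k i)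
    = q powi (- rho2 k) * (q powi (nrm l - rho2 l) * of_bool (l < mir k) - nu * of_bool (k \<le> l \<and> l < mir l))"
proof -
  have "(\<Sum>i\<in>{l<..N}. q powi (- rho2 i) * R_infinity_block k i) = (\<Sum>i\<in>{l<..N}.
      of_bool (i = mir k) * q powi (- nrm k) + nu * q powi (- rho2 k) * of_bool (k < mir k) * of_bool (i = k)
      - nu * q powi (- rho2 k) * (of_bool (i < mir k) * (of_int (sg i) * q powi (- rho2 i))))"
  proof (rule sum.cong)
    fix i assume i: "i \<in> {l<..N}"
    then have "i \<in> {1..N}" by auto
    then have "k = mir i \<longleftrightarrow> i = mir k" using k by (metis mir_mir)
    moreover have "q powi (- rho2 i) * q powi (rho2 i - nrm i) = q powi (- nrm i)"
      by (simp flip: power_int_add)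
    ultimately show "q powi (- rho2 i) * R_infinity_block k i = of_bool (i = mir k) * q powi (- nrm k)
      + nu * q powi (- rho2 k) * of_bool (k < mir k) * of_bool (i = k)
      - nu * q powi (- rho2 k) * (of_bool (i < mir k) * (of_int (sg i) * q powi (- rho2 i)))"
      using k by (auto simp: R_infinity_block_def algebra_simps)
  qed simp
  also have "\<dots> = of_bool (l < mir k) * q powi (- nrm k) + nu * q powi (- rho2 k) * of_bool (l < k \<and> k < mir k)
      - q powi (- rho2 k) * (nu * (\<Sum>i\<in>{l<..<mir k}. of_int (sg i) * q powi (- rho2 i)))"
  proof -
    have "(\<Sum>i\<in>{l<..N}. of_bool (i < mir k) * (of_int (sg i) * q powi (- rho2 i)))
      = (\<Sum>i\<in>{l<..<mir k}. of_int (sg i) * q powi (- rho2 i))"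
      by (rule sum.mono_neutral_cong_right) (use mir_in[OF k] in auto)
    moreover have "(\<Sum>i\<in>{l<..N}. of_bool (i = mir k) * q powi (- nrm k)) = of_bool (l < mir k) * q powi (- nrm k)"
      using mir_in[OF k] by (simp add: of_bool_def if_distrib[of "\<lambda>x. x * _"] cong: if_cong)
    moreover have "(\<Sum>i\<in>{l<..N}. nu * q powi (- rho2 k) * of_bool (k < mir k) * of_bool (i = k))
      = nu * q powi (- rho2 k) * of_bool (l < k \<and> k < mir k)"
      using k by (simp add: of_bool_def if_distrib[of "\<lambda>x. _ * x"] cong: if_cong)
    ultimately show ?thesis
      by (simp only: sum.distrib sum_subtractf sum_distrib_left[symmetric] mult.assoc) (simp only: mult_ac)
  qed
  also have "\<dots> = q powi (- rho2 k) * (q powi (nrm l - rho2 l) * of_bool (l < mir k) - nu * of_bool (k \<le> l \<and> l < mir l))"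
  proof (cases "l < mir k")
    case True
    have S: "nu * (\<Sum>i\<in>{l<..<mir k}. of_int (sg i) * q powi (- rho2 i))
      = q powi (rho2 k - nrm k) - q powi (nrm l - rho2 l) + nu * of_bool (l < mir l \<and> k < mir k)"
      using weighted_geometric_sum[of l "mir k"] True mir_in[OF k] k l by simp
    have E: "q powi (- rho2 k) * q powi (rho2 k - nrm k) = q powi (- nrm k)"
      by (simp flip: power_int_add)
    have B: "(of_bool (l < mir l \<and> k < mir k) :: 'a) = of_bool (l < k \<and> k < mir k) + of_bool (k \<le> l \<and> l < mir l)"
      using True k l by (auto simp: mirror_def of_bool_def)
    show ?thesis unfolding S B right_diff_distrib distrib_left E
      using True by (simp add: mult_ac split del: split_of_bool)
  next
    case False
    then have "\<not> (l < k \<and> k < mir k)" "\<not> (k \<le> l \<and> l < mir l)" "{l<..<mir k} = {}"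
      using k l by (auto simp: mirror_def)
    then show ?thesis using False by (simp only: of_bool_eq sum.empty) simp
  qed
  finally show ?thesis .
qed

text \<open>
  A column of the second block consists of two isolated entries and of a multiple of the vector with
  entries \<open>q\<close> to the power \<open>-2 (\<rho>, \<epsilon>\<^sub>i)\<close>, restricted to the \<open>i\<close> above the mirror image of the column
  index.  On the latter the first block acts as computed in \<open>R_infinity_block_tail_sum\<close>.
\<close>

lemma R_infinity_block_R_zero_block:
  assumes k: "k \<in> {1..N}" and j: "j \<in> {1..N}"
  shows "(\<Sum>i = 1..N. R_infinity_block k i * R_zero_block i j) = of_bool (k = j)"
proof -
  define l where "l = mir j"
  have l: "l \<in> {1..N}" and jl: "j = mir l" using j mir_in[OF j] by (simp_all add: l_def del: mir_in)
  have "(\<Sum>i = 1..N. R_infinity_block k i * R_zero_block i j) = (\<Sum>i = 1..N.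
      q powi (nrm l - rho2 l) * (of_bool (i = l) * R_infinity_block k i) - nu * of_bool (l < mir l) * (of_bool (i = mir l) * R_infinity_block k i)
      + nu * of_int (sg l) * (of_bool (l < i) * (q powi (- rho2 i) * R_infinity_block k i)))"
  proof (rule sum.cong)
    fix i assume i: "i \<in> {1..N}"
    then have "mir i < mir l \<longleftrightarrow> l < i" using l by (auto simp: mirror_def)
    then show "R_infinity_block k i * R_zero_block i j = q powi (nrm l - rho2 l) * (of_bool (i = l) * R_infinity_block k i)
      - nu * of_bool (l < mir l) * (of_bool (i = mir l) * R_infinity_block k i)
      + nu * of_int (sg l) * (of_bool (l < i) * (q powi (- rho2 i) * R_infinity_block k i))"
      using l i by (simp add: R_zero_block_def jl algebra_simps of_bool_conj)
  qed simp
  also have "\<dots> = q powi (nrm l - rho2 l) * R_infinity_block k l - nu * of_bool (l < mir l) * R_infinity_block k (mir l)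
      + nu * of_int (sg l) * (\<Sum>i\<in>{l<..N}. q powi (- rho2 i) * R_infinity_block k i)"
  proof -
    have "(\<Sum>i = 1..N. of_bool (l < i) * (q powi (- rho2 i) * R_infinity_block k i)) = (\<Sum>i\<in>{l<..N}. q powi (- rho2 i) * R_infinity_block k i)"
      by (rule sum.mono_neutral_cong_right) (use l in auto)
    moreover have "(\<Sum>i = 1..N. of_bool (i = x) * R_infinity_block k i) = R_infinity_block k x" if "x \<in> {1..N}" for x
      using that by (simp add: of_bool_def if_distrib[of "\<lambda>x. x * _"] cong: if_cong)
    ultimately show ?thesis
      using l mir_in[OF l] by (simp only: sum.distrib sum_subtractf sum_distrib_left[symmetric])
  qed
  also have "\<dots> = of_bool (k = mir l)"
  proof -
    define s E V W :: 'a where "s = of_int (sg l)" and "E = q powi (- rho2 k)"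
      and "V = q powi (nrm l - rho2 l)" and "W = q powi (- nrm l - rho2 l)"
    define K' K L M T :: 'a where "K' = of_bool (k = mir l)" and "K = of_bool (k = l)"
      and "L = of_bool (l < mir l)" and "M = of_bool (k < l)" and "T = of_bool (l < mir k)"
    note defs = s_def E_def V_def W_def K'_def K_def L_def M_def T_def
    have VV: "V * q powi (rho2 l - nrm l) = 1" by (simp add: V_def flip: power_int_add)
    have cond: "mir l < mir k \<longleftrightarrow> k < l" using k l by (auto simp: mirror_def)
    have 1: "V * R_infinity_block k l = K' + nu * (V * L * K - s * E * V * T)"
      using VV by (simp add: R_infinity_block_def defs of_bool_conj algebra_simps split del: split_of_bool)
    have swap: "- rho2 l - nrm l = - nrm l - rho2 l" by simp
    have 2: "L * R_infinity_block k (mir l) = L * (W * K - nu * (s * E * M))"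
      using l cond by (cases "l < mir l") (simp_all add: R_infinity_block_def defs swap split del: split_of_bool)
    have 3: "of_bool (k \<le> l \<and> l < mir l) = L * (M + K)"
      by (auto simp: defs of_bool_def)
    have "nu * s * q powi (- rho2 l) = V - W" if "l < mir l"
      using nu_sg[OF l] that by (simp add: defs left_diff_distrib flip: power_int_add)
    then have 4: "L * K * (nu * s * E) = L * K * (V - W)" by (simp add: defs)
    have "V * R_infinity_block k l - nu * L * R_infinity_block k (mir l) + nu * s * (E * (V * T - nu * (L * (M + K))))
      = K' + nu * (L * K * (V - W) - L * K * (nu * s * E))"
      unfolding 1 mult.assoc[of nu L] 2 by (simp add: algebra_simps)
    then show ?thesis
      unfolding R_infinity_block_tail_sum[OF k l] 3 using 4 by (simp only: defs) simp
  qed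
  finally show ?thesis by (simp add: jl)
qed


section \<open>The entries of the R-matrices\<close>

text \<open>
  The factor by which \<open>v\<^sub>i \<otimes> v\<^sub>i\<^sub>'\<close> is rescaled.
\<close>

definition scl :: "nat \<Rightarrow> 'a" where "scl i = of_int (th i) * h powi rho2 i"

text \<open>
  The integer \<open>(\<epsilon>\<^sub>c, \<epsilon>\<^sub>d)\<close>.
\<close>

definition pairing :: "nat \<Rightarrow> nat \<Rightarrow> int" where
  "pairing c d = (if d = c then nrm c else if d = mir c then - nrm c else 0)"

text \<open>
  In the next four functions \<open>a b\<close> number the row \<open>v\<^sub>a \<otimes> v\<^sub>b\<close> and \<open>c d\<close> the column \<open>v\<^sub>c \<otimes> v\<^sub>d\<close>.
\<close>

definition tau_fn :: "nat \<Rightarrow> nat \<Rightarrow> nat \<Rightarrow> nat \<Rightarrow> 'a" where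
  "tau_fn a b c d = of_bool (a = d \<and> b = c) * (- 1) ^ (p c * p d)"

definition Q_fn :: "nat \<Rightarrow> nat \<Rightarrow> nat \<Rightarrow> nat \<Rightarrow> 'a" where
  "Q_fn a b c d = of_bool (b = mir a \<and> d = mir c) * of_int (sg c) * (scl a / scl c)"

definition R_zero_fn :: "nat \<Rightarrow> nat \<Rightarrow> nat \<Rightarrow> nat \<Rightarrow> 'a" where
  "R_zero_fn a b c d = of_bool (a = c \<and> b = d) * q powi (- pairing c d)
     - nu * of_bool (a < c) * (tau_fn a b c d - Q_fn a b c d)"

definition R_infinity_fn :: "nat \<Rightarrow> nat \<Rightarrow> nat \<Rightarrow> nat \<Rightarrow> 'a" where
  "R_infinity_fn a b c d = of_bool (a = c \<and> b = d) * q powi (pairing c d)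
     + nu * of_bool (c < a) * (tau_fn a b c d - Q_fn a b c d)"

lemma h_powi_double: "h powi (2 * k) = q powi k"
  by (simp add: q_def power_int_mult)

lemma scl_nonzero [simp]: "i \<in> {1..N} \<Longrightarrow> scl i \<noteq> 0"
  using sign[of i] h_nonzero by (auto simp: scl_def)

text \<open>
  The exponents of \<open>h\<close> in the two factors are opposite, so that their quotient involves only \<open>q = h\<^sup>2\<close>;
  the signs \<open>\<vartheta>\<close> differ exactly if \<open>i\<close> is odd.
\<close>

lemma scl_mir:
  assumes i: "i \<in> {1..N}"
  shows "scl (mir i) = of_int (sg i) * q powi (- rho2 i) * scl i"
proof -
  have "h powi (- rho2 i) = q powi (- rho2 i) * h powi rho2 i"
    using h_nonzero by (simp add: q_def power_int_power power_int_minus field_simps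
        flip: power_int_add power_int_mult)
  moreover have "th (mir i) = sg i * th i"
    using parity[OF i] sign_odd[OF i] sign_even[OF i] sign_even[OF mir_in[OF i]] parity_mirror[OF i]
    by (auto simp: sg_def)
  ultimately show ?thesis using i by (simp add: scl_def)
qed

lemma sg_times_sg [simp]: "i \<in> {1..N} \<Longrightarrow> (of_int (sg i) :: 'a) * of_int (sg i) = 1"
  using sg_cases[of i] by auto

lemma sign_square: "i \<in> {1..N} \<Longrightarrow> (- 1 :: 'a) ^ (p i * p i) = of_int (sg i)"
  using parity[of i] by (auto simp: sg_def)

text \<open>
  Off the diagonal blocks \<open>a = c\<close> the two triangular sums add up to the full sum of \<open>\<tau> - Q\<close>.  For \<open>a = c\<close> the
  operators are diagonal, with eigenvalues \<open>q\<close> to the powers \<open>\<plusminus>(\<epsilon>\<^sub>c, \<epsilon>\<^sub>d)\<close>, and the difference of the two powers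
  is \<open>\<plusminus>\<nu>\<close> or \<open>0\<close>.
\<close>

lemma skein_entries:
  assumes "c \<in> {1..N}" "d \<in> {1..N}"
  shows "R_infinity_fn a b c d - R_zero_fn a b c d = nu * (tau_fn a b c d - Q_fn a b c d)"
proof (cases "a = c")
  case True
  then show ?thesis
    using assms nu_sg[OF assms(1)] sign_square[OF assms(1)]
    by (auto simp: R_infinity_fn_def R_zero_fn_def tau_fn_def Q_fn_def pairing_def nrm_def algebra_simps)
next
  case False
  then show ?thesis by (auto simp: R_infinity_fn_def R_zero_fn_def algebra_simps of_bool_def)
qed

lemma scl_ratio:
  assumes c: "c \<in> {1..N}"
  shows "of_bool (a = mir c) * (scl a / scl c * q powi (rho2 c + k)) = of_bool (a = mir c) * (of_int (sg c) * q powi k)"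
  using c by (auto simp: scl_mir power_int_add power_int_minus)

lemma pairing_mir: "pairing c (mir c) = - nrm c"
  by (auto simp: pairing_def nrm_def)

lemma zero_weight_tau_fn: "c \<in> {1..N} \<Longrightarrow> a \<in> {1..N} \<Longrightarrow> tau_fn (mir a) a c (mir c) = of_bool (a = c) * of_int (sg c)"
  using mir_mir[of a] mir_mir[of c] by (auto simp: tau_fn_def parity_mirror sign_square)

lemma zero_weight_Q_fn:
  assumes "a \<in> {1..N}"
  shows "of_int (sg a) * Q_fn (mir a) a c (mir c) = of_int (sg c) * q powi (- rho2 a) * (scl a / scl c)"
proof -
  have "of_int (sg a) * Q_fn (mir a) a c (mir c)
      = (of_int (sg a) * of_int (sg a)) * (of_int (sg c) * q powi (- rho2 a) * (scl a / scl c))"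
    using assms by (simp add: Q_fn_def scl_mir)
  then show ?thesis using assms by simp
qed

lemma zero_weight_diag:
  assumes a: "a \<in> {1..N}" and c: "c \<in> {1..N}"
  shows "of_int (sg a) * (of_bool (mir a = c \<and> a = mir c) * q powi k)
     = scl a / scl c * (q powi (rho2 c + k) * of_bool (a = mir c))"
proof -
  have "scl a / scl c * (q powi (rho2 c + k) * of_bool (a = mir c)) = of_bool (a = mir c) * (of_int (sg c) * q powi k)"
    using scl_ratio[OF c, of a k] by (simp only: mult_ac)
  then show ?thesis using a c by auto
qed

text \<open>
  On the zero weight space \<open>\<tau>\<close> turns the row \<open>v\<^sub>a\<^sub>' \<otimes> v\<^sub>a\<close> into the row \<open>v\<^sub>a \<otimes> v\<^sub>a\<^sub>'\<close> with the sign of \<open>a\<close>;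
  undoing the rescaling of the basis produces the quotient of the scaling factors.
\<close>

lemma zero_weight_R_infinity_fn:
  assumes a: "a \<in> {1..N}" and c: "c \<in> {1..N}"
  shows "of_int (sg a) * R_infinity_fn (mir a) a c (mir c) = scl a / scl c * R_infinity_block a c"
proof -
  have "of_int (sg a) * R_infinity_fn (mir a) a c (mir c)
    = of_int (sg a) * (of_bool (mir a = c \<and> a = mir c) * q powi (- nrm c))
     + nu * of_bool (c < mir a) * (of_int (sg a) * of_int (sg c) * of_bool (a = c) - of_int (sg a) * Q_fn (mir a) a c (mir c))"
    by (simp add: R_infinity_fn_def pairing_mir zero_weight_tau_fn[OF c a] algebra_simps)
  also have "\<dots> = scl a / scl c * R_infinity_block a c"
    unfolding zero_weight_diag[OF a c] zero_weight_Q_fn[OF a] R_infinity_block_def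
    using a c by (cases "a = c") (auto simp: algebra_simps)
  finally show ?thesis .
qed

lemma zero_weight_R_zero_fn:
  assumes a: "a \<in> {1..N}" and c: "c \<in> {1..N}"
  shows "of_int (sg a) * R_zero_fn (mir a) a c (mir c) = scl a / scl c * R_zero_block a c"
proof -
  have "of_int (sg a) * R_zero_fn (mir a) a c (mir c)
    = of_int (sg a) * (of_bool (mir a = c \<and> a = mir c) * q powi (nrm c))
     - nu * of_bool (mir a < c) * (of_int (sg a) * of_int (sg c) * of_bool (a = c) - of_int (sg a) * Q_fn (mir a) a c (mir c))"
    by (simp add: R_zero_fn_def pairing_mir zero_weight_tau_fn[OF c a] algebra_simps)
  also have "\<dots> = scl a / scl c * R_zero_block a c"
    unfolding zero_weight_diag[OF a c] zero_weight_Q_fn[OF a] R_zero_block_def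
    using a c by (cases "a = c") (auto simp: algebra_simps)
  finally show ?thesis .
qed

text \<open>
  A row of zero weight meets only columns of zero weight.
\<close>

lemma zero_weight_row_R_infinity_fn:
  assumes "a \<in> {1..N}" "x \<in> {1..N}" "y \<in> {1..N}"
  shows "(- 1) ^ (p a * p (mir a)) * R_infinity_fn (mir a) a x y = of_bool (y = mir x) * (scl a / scl x * R_infinity_block a x)"
proof (cases "y = mir x")
  case True
  then show ?thesis using zero_weight_R_infinity_fn[OF assms(1,2)] assms by (simp add: parity_mirror sign_square)
next
  case False
  then have "R_infinity_fn (mir a) a x y = 0" using assms by (auto simp: R_infinity_fn_def tau_fn_def Q_fn_def)
  with False show ?thesis by simp
qed

lemma zero_weight_row_R_zero_fn:
  assumes "a \<in> {1..N}" "x \<in> {1..N}" "y \<in> {1..N}"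
  shows "(- 1) ^ (p a * p (mir a)) * R_zero_fn (mir a) a x y = of_bool (y = mir x) * (scl a / scl x * R_zero_block a x)"
proof (cases "y = mir x")
  case True
  then show ?thesis using zero_weight_R_zero_fn[OF assms(1,2)] assms by (simp add: parity_mirror sign_square)
next
  case False
  then have "R_zero_fn (mir a) a x y = 0" using assms by (auto simp: R_zero_fn_def tau_fn_def Q_fn_def)
  with False show ?thesis by simp
qed

lemma sum_pair_delta:
  fixes G :: "nat \<Rightarrow> nat \<Rightarrow> 'a"
  assumes "a \<in> {1..N}" "b \<in> {1..N}"
  shows "(\<Sum>x = 1..N. \<Sum>y = 1..N. of_bool (x = a \<and> y = b) * G x y) = G a b"
proof -
  have "(\<Sum>x = 1..N. \<Sum>y = 1..N. of_bool (x = a \<and> y = b) * G x y)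
     = (\<Sum>x = 1..N. if x = a then \<Sum>y = 1..N. if y = b then G x y else 0 else 0)"
    by (intro sum.cong refl) (auto intro!: sum.cong)
  then show ?thesis using assms by simp
qed

text \<open>
  The entries of \<open>(\<tau> R\<^sub>\<infinity>) (\<tau> R\<^sub>0)\<close>.  A row of zero weight is settled by the blocks.  In any other row
  \<open>Q\<close> does not occur, and only the two columns numbered \<open>(a, b)\<close> and \<open>(b, a)\<close> contribute.
\<close>

lemma R_hat_product_entries:
  assumes a: "a \<in> {1..N}" and b: "b \<in> {1..N}" and c: "c \<in> {1..N}" and d: "d \<in> {1..N}"
  shows "(\<Sum>x = 1..N. \<Sum>y = 1..N. ((-1) ^ (p a * p b) * R_infinity_fn b a x y) * ((-1) ^ (p x * p y) * R_zero_fn y x c d))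
     = of_bool (a = c \<and> b = d)"
proof (cases "b = mir a")
  case True
  have "(\<Sum>x = 1..N. \<Sum>y = 1..N. ((-1) ^ (p a * p b) * R_infinity_fn b a x y) * ((-1) ^ (p x * p y) * R_zero_fn y x c d))
    = (\<Sum>x = 1..N. \<Sum>y = 1..N. if y = mir x then of_bool (d = mir c) * (scl a / scl c) * (R_infinity_block a x * R_zero_block x c) else 0)"
  proof (intro sum.cong refl)
    fix x y assume x: "x \<in> {1..N}" and y: "y \<in> {1..N}"
    show "((-1) ^ (p a * p b) * R_infinity_fn b a x y) * ((-1) ^ (p x * p y) * R_zero_fn y x c d)
      = (if y = mir x then of_bool (d = mir c) * (scl a / scl c) * (R_infinity_block a x * R_zero_block x c) else 0)"
      unfolding True zero_weight_row_R_infinity_fn[OF a x y]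
      using zero_weight_row_R_zero_fn[OF x c d] scl_nonzero[OF x] by (simp add: field_simps)
  qed
  also have "\<dots> = of_bool (d = mir c) * (scl a / scl c) * (\<Sum>x = 1..N. R_infinity_block a x * R_zero_block x c)"
    unfolding sum_distrib_left by (intro sum.cong refl) (use mir_in in auto)
  also have "\<dots> = of_bool (a = c \<and> b = d)"
    unfolding R_infinity_block_R_zero_block[OF a c] using True a by auto
  finally show ?thesis .
next
  case False
  then have False': "a \<noteq> mir b" using b by auto
  let ?s = "(-1 :: 'a) ^ (p a * p b)"
  have ss: "?s * (?s * t) = t" for t by (simp flip: mult.assoc power_add)
  have "(\<Sum>x = 1..N. \<Sum>y = 1..N. (?s * R_infinity_fn b a x y) * ((-1) ^ (p x * p y) * R_zero_fn y x c d))
    = (\<Sum>x = 1..N. \<Sum>y = 1..N.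
         of_bool (x = b \<and> y = a) * (?s * q powi (pairing x y) * ((-1) ^ (p x * p y) * R_zero_fn y x c d))
       + of_bool (x = a \<and> y = b) * (nu * of_bool (x < y) * ((-1) ^ (p x * p y) * R_zero_fn y x c d)))"
    by (intro sum.cong refl)
       (auto simp: R_infinity_fn_def tau_fn_def Q_fn_def False' algebra_simps simp flip: power_add)
  also have "\<dots> = ?s * q powi (pairing b a) * (?s * R_zero_fn a b c d) + nu * of_bool (a < b) * (?s * R_zero_fn b a c d)"
    unfolding sum.distrib sum_pair_delta[OF a b] sum_pair_delta[OF b a] by (simp add: mult.commute[of "p b"])
  also have "\<dots> = q powi (pairing b a) * R_zero_fn a b c d + nu * of_bool (a < b) * (?s * R_zero_fn b a c d)"
    using ss by (simp add: mult_ac)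
  also have "\<dots> = of_bool (a = c \<and> b = d)"
  proof -
    have 1: "R_zero_fn a b c d = of_bool (a = c \<and> b = d) * q powi (- pairing a b) - nu * of_bool (a < b) * (of_bool (a = d \<and> b = c) * ?s)"
      using False by (auto simp: R_zero_fn_def tau_fn_def Q_fn_def mult.commute)
    have 2: "R_zero_fn b a c d = of_bool (b = c \<and> a = d) * q powi (- pairing b a) - nu * of_bool (b < a) * (of_bool (b = d \<and> a = c) * ?s)"
      using False' by (auto simp: R_zero_fn_def tau_fn_def Q_fn_def mult.commute)
    have 3: "pairing b a = pairing a b" and 4: "a \<noteq> b \<Longrightarrow> pairing a b = 0"
      using False False' by (auto simp: pairing_def)
    have 5: "q powi (pairing a b) * q powi (- pairing a b) = 1" by (simp flip: power_int_add)
    show ?thesis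
      unfolding 1 2 3 using 4 5
      by (cases "a < b") (auto simp: right_diff_distrib mult.left_commute simp flip: mult.assoc)
  qed
  finally show ?thesis .
qed

end

section \<open>From labels to numbers\<close>

lemma inj_basis_no: "inj (basis_no :: 'i::{finite,linorder} \<Rightarrow> nat)"
proof (rule linorder_injI)
  fix x y :: 'i assume "x < y"
  then have "{..x} \<subset> {..y}" by auto
  then have "basis_no x < basis_no y" unfolding basis_no_def by (intro psubset_card_mono) auto
  then show "basis_no x \<noteq> basis_no y" by simp
qed

lemma bij_basis_no: "bij_betw (basis_no :: 'i::{finite,linorder} \<Rightarrow> nat) UNIV {1..CARD('i)}"
proof -
  have "basis_no x \<in> {1..CARD('i)}" for x :: 'i
    unfolding basis_no_def by (auto simp: Suc_le_eq card_gt_0_iff intro!: card_mono)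
  then have "range (basis_no :: 'i \<Rightarrow> nat) = {1..CARD('i)}"
    by (intro card_subset_eq) (auto simp: card_image[OF inj_basis_no])
  then show ?thesis using inj_basis_no by (simp add: bij_betw_def)
qed

lemma basis_no_in: "basis_no (x :: 'i::{finite,linorder}) \<in> {1..CARD('i)}"
  using bij_betwE[OF bij_basis_no] by blast

lemma sum_labels: "(\<Sum>x\<in>(UNIV :: 'i::{finite,linorder} set). f (basis_no x)) = (\<Sum>i = 1..CARD('i). f i)"
  by (rule sum.reindex_bij_betw[OF bij_basis_no])

lemma Emat_entry: "Emat i j $ x $ y = of_bool (basis_no x = i \<and> basis_no y = j)"
  by (simp add: Emat_def)

text \<open>
  The three kinds of sums in the definitions of the R-matrices are instances: \<open>J i\<close> is a one-point set,
  one of the two sides of \<open>i\<close>, or the whole range.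
\<close>

lemma gtensor_sum_entry:
  fixes r c :: "'i::{finite,linorder} \<times> 'i" and F :: "nat \<Rightarrow> nat \<Rightarrow> 'a::comm_ring_1"
  assumes "\<And>i. finite (J i)" and N: "CARD('i) = N"
  shows "(\<Sum>i = 1..N. \<Sum>j\<in>J i. F i j \<odot> gtensor p (Emat i j) (Y i j)) $ r $ c =
    (let a = basis_no (fst r); b = basis_no (snd r); c1 = basis_no (fst c); d = basis_no (snd c) in
      of_bool (c1 \<in> J a) * (F a c1 * (- 1) ^ ((p b + p d) * p c1) * Y a c1 $ snd r $ snd c))"
proof -
  let ?G = "\<lambda>i j. F i j * (- 1) ^ ((p (basis_no (snd r)) + p (basis_no (snd c))) * p j) * Y i j $ snd r $ snd c"
  have "(F i j \<odot> gtensor p (Emat i j) (Y i j)) $ r $ c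
     = (if i = basis_no (fst r) then if j = basis_no (fst c) then ?G i j else 0 else 0)" for i j
    by (simp add: gtensor_def Emat_def)
  then have "(\<Sum>i = 1..N. \<Sum>j\<in>J i. F i j \<odot> gtensor p (Emat i j) (Y i j)) $ r $ c =
    (\<Sum>i = 1..N. \<Sum>j\<in>J i. if i = basis_no (fst r) then if j = basis_no (fst c) then ?G i j else 0 else 0)"
    by (simp only: sum_component)
  also have "\<dots> = (\<Sum>i = 1..N. if i = basis_no (fst r) then \<Sum>j\<in>J i. if j = basis_no (fst c) then ?G i j else 0 else 0)"
    by (intro sum.cong refl) simp
  finally show ?thesis using basis_no_in[of "fst r"] assms by (simp add: Let_def)
qed

lemma qpow_half_int: "qpow h (of_int k / 2) = h powi k"
  by (simp add: qpow_def)

lemma qpow_consts: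
  "qpow h (1/2) = h" "qpow h (-1/2) = inverse h" "qpow h 1 = h\<^sup>2" "qpow h (-1) = inverse (h\<^sup>2)"
  using qpow_half_int[of h 1] qpow_half_int[of h "-1"] qpow_half_int[of h 2] qpow_half_int[of h "-2"]
  by (simp_all add: power_int_minus)

lemma gtensor_diag_entry:
  fixes r c :: "'i::{finite,linorder} \<times> 'i" and F :: "nat \<Rightarrow> 'a::comm_ring_1"
  assumes "CARD('i) = N"
  shows "(\<Sum>i = 1..N. F i \<odot> gtensor p (Emat i i) (Y i)) $ r $ c =
    (let a = basis_no (fst r); b = basis_no (snd r); c1 = basis_no (fst c); d = basis_no (snd c) in
      of_bool (a = c1) * (F a * (- 1) ^ ((p b + p d) * p c1) * Y a $ snd r $ snd c))"
  using gtensor_sum_entry[of "\<lambda>i. {i}" N "\<lambda>i j. F i" p "\<lambda>i j. Y i" r c] assms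
  by (simp add: Let_def eq_commute[of "basis_no (fst c)"])

lemma basis_no_eq_iff [simp]: "basis_no x = basis_no y \<longleftrightarrow> x = (y :: 'i::{finite,linorder})"
  using inj_basis_no by (auto simp: inj_def)

lemma tau_mult_entry:
  "(tau p ** X) $ r $ c = (- 1) ^ (p (basis_no (fst r)) * p (basis_no (snd r))) * X $ (snd r, fst r) $ c"
proof -
  have "(tau p ** X) $ r $ c = (\<Sum>k\<in>UNIV. if k = (snd r, fst r)
      then (- 1) ^ (p (basis_no (fst r)) * p (basis_no (snd r))) * X $ k $ c else 0)"
    unfolding matrix_matrix_mult_def tau_def vec_lambda_beta
    by (rule sum.cong) (auto simp: mult.commute prod_eq_iff)
  then show ?thesis by simp
qed

lemma matrix_inv_eqI:
  fixes A B :: "'a::semiring_1^'n^'n"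
  assumes "A ** B = mat 1" "B ** A = mat 1"
  shows "matrix_inv A = B"
proof -
  have "A ** matrix_inv A = mat 1 \<and> matrix_inv A ** A = mat 1"
    unfolding matrix_inv_def by (rule someI[of _ B]) (use assms in simp)
  then show ?thesis using assms(2) by (metis matrix_mul_assoc matrix_mul_lid matrix_mul_rid)
qed

context osp_data
begin

lemma sign_ratio:
  assumes a: "a \<in> {1..N}" and c: "c \<in> {1..N}"
  shows "of_int (th a) * of_int (th c) * qpow h (wform N p (rho N p) (eps N a - eps N c)) = scl a / scl c"
  using sign[OF c] h_nonzero unfolding wform_rho_diff[OF a c] qpow_half_int
  by (auto simp: scl_def power_int_diff)

text \<open>
  All signs, including the one that the graded tensor product adds, combine to those of \<open>\<tau>\<close> and \<open>Q\<close>.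
\<close>

lemma offdiag_entry:
  assumes a: "a \<in> {1..N}" and c: "c \<in> {1..N}"
  shows "(- 1) ^ p c * (- 1) ^ ((p b + p d) * p c) * (of_bool (b = c \<and> d = a)
     - ((- 1) ^ (p c * (p a + p c)) * of_int (th a) * of_int (th c)
          * qpow h (wform N p (rho N p) (eps N a - eps N c))) * of_bool (b = mir a \<and> d = mir c))
     = tau_fn a b c d - Q_fn a b c d"
proof -
  have 1: "(- 1 :: 'a) ^ p c * (- 1) ^ ((p c + p a) * p c) = (- 1) ^ (p c * p a)"
    "(- 1 :: 'a) ^ p c * (- 1) ^ ((p a + p c) * p c) * (- 1) ^ (p c * (p a + p c)) = of_int (sg c)"
    using parity[OF a] parity[OF c] by (auto simp: sg_def)
  have "(- 1) ^ p c * (- 1) ^ ((p b + p d) * p c) * (of_bool (b = c \<and> d = a)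
     - ((- 1) ^ (p c * (p a + p c)) * (scl a / scl c)) * of_bool (b = mir a \<and> d = mir c))
    = of_bool (b = c \<and> d = a) * ((- 1) ^ p c * (- 1) ^ ((p c + p a) * p c))
     - of_bool (b = mir a \<and> d = mir c) *
         ((- 1) ^ p c * (- 1) ^ ((p a + p c) * p c) * (- 1) ^ (p c * (p a + p c))) * (scl a / scl c)"
    using parity_mirror[OF a] parity_mirror[OF c] by (simp add: algebra_simps)
  then show ?thesis
    unfolding mult.assoc[of _ "of_int (th a)"] mult.assoc[of _ "of_int (th a) * of_int (th c)"] sign_ratio[OF a c] 1
    by (auto simp: tau_fn_def Q_fn_def)
qed

text \<open>
  The correction to the identity in the diagonal terms turns the eigenvalue \<open>1\<close> into a power of \<open>q\<close>.  With
  \<open>k = h\<close> this describes \<open>R\<^sub>0\<close>, with the inverse of \<open>h\<close> for \<open>k\<close> it describes \<open>R\<^sub>\<infinity>\<close>.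
\<close>

lemma diag_entry:
  fixes k :: 'a
  assumes c: "c \<in> {1..N}" and k: "k \<noteq> 0"
  shows "of_bool (b = d) + (inverse k - k) * ((- 1) ^ p c * (- 1) ^ ((p b + p d) * p c)
      * (k powi (- nrm c) * of_bool (b = c \<and> d = c) - k powi (nrm c) * of_bool (b = mir c \<and> d = mir c)))
    = of_bool (b = d) * k powi (- (2 * pairing c d))"
proof (cases "b = d")
  case True
  have sgn: "(- 1 :: 'a) ^ ((p d + p d) * p c) = 1"
    by (metis mult_2 even_mult_iff even_numeral neg_one_even_power)
  have "(- 1 :: 'a) ^ p c = of_int (sg c)" by (simp add: sg_def)
  then show ?thesis unfolding True sgn
    using sg_cases[OF c] k
    by (auto simp: pairing_def nrm_def power_int_minus field_simps power2_eq_square)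
next
  case False
  then show ?thesis by auto
qed

lemma R_zero_entry:
  fixes r c :: "'i::{finite,linorder} \<times> 'i"
  assumes N: "CARD('i) = N"
  shows "(R_zero N p th h :: ('a, 'i) end_VV) $ r $ c
    = R_zero_fn (basis_no (fst r)) (basis_no (snd r)) (basis_no (fst c)) (basis_no (snd c))"
proof -
  define a b c1 d where "a = basis_no (fst r)" and "b = basis_no (snd r)"
    and "c1 = basis_no (fst c)" and "d = basis_no (snd c)"
  note defs = a_def b_def c1_def d_def
  have a: "a \<in> {1..N}" and c1: "c1 \<in> {1..N}"
    unfolding defs using basis_no_in N by metis+
  have mat: "(mat 1 :: ('a, 'i) end_VV) $ r $ c = of_bool (a = c1) * of_bool (b = d)"
    by (auto simp: mat_def defs prod_eq_iff)
  have half: "qpow h (- (of_int k :: rat) / 2) = h powi (- k)" for k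
    using qpow_half_int[of h "- k"] by simp
  have diag: "of_bool (a = c1) * of_bool (b = d) + (inverse h - h) * (of_bool (a = c1)
      * ((- 1) ^ p a * (- 1) ^ ((p b + p d) * p c1)
      * (h powi (- nrm a) * of_bool (b = a \<and> d = a) - h powi (nrm a) * of_bool (b = mir a \<and> d = mir a))))
    = of_bool (a = c1 \<and> b = d) * q powi (- pairing c1 d)"
    using diag_entry[OF c1 h_nonzero, of b d]
      h_powi_double[of "- pairing c1 d"] by (cases "a = c1") simp_all
  have q: "inverse (h\<^sup>2) - h\<^sup>2 = - nu" by (simp add: nu_def q_def)
  show ?thesis
    unfolding R_zero_def qpow_consts vector_add_component nth_map_matrix
      gtensor_diag_entry[OF N] gtensor_sum_entry[OF finite_atLeastAtMost N] Let_def
      mat defs[symmetric] vector_minus_component Emat_entry wform_eps_eps[OF a] half qpow_half_int diag q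
    using offdiag_entry[OF a c1, of b d] c1 by (auto simp: R_zero_fn_def)
qed

lemma Q_entry:
  fixes r c :: "'i::{finite,linorder} \<times> 'i"
  assumes N: "CARD('i) = N"
  shows "(\<Sum>i = 1..N. \<Sum>j = 1..N.
             ((- 1) ^ (p i * p j) * of_int (th i) * of_int (th j)
              * qpow h (wform N p (rho N p) (eps N i - eps N j))) \<odot>
             gtensor p (Emat i j) (Emat (mir i) (mir j)) :: ('a, 'i) end_VV) $ r $ c
    = Q_fn (basis_no (fst r)) (basis_no (snd r)) (basis_no (fst c)) (basis_no (snd c))"
proof -
  define a b c1 d where "a = basis_no (fst r)" and "b = basis_no (snd r)"
    and "c1 = basis_no (fst c)" and "d = basis_no (snd c)"
  note defs = a_def b_def c1_def d_def
  have a: "a \<in> {1..N}" and c1: "c1 \<in> {1..N}"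
    unfolding defs using basis_no_in N by metis+
  have sgn: "(- 1 :: 'a) ^ (p a * p c1) * (- 1) ^ ((p a + p c1) * p c1) = of_int (sg c1)"
    using parity[OF a] parity[OF c1] by (auto simp: sg_def)
  have "of_bool (c1 \<in> {1..N}) * ((- 1) ^ (p a * p c1) * (scl a / scl c1) * (- 1) ^ ((p b + p d) * p c1) *
      of_bool (b = mir a \<and> d = mir c1))
    = of_bool (b = mir a \<and> d = mir c1) * ((- 1) ^ (p a * p c1) * (- 1) ^ ((p a + p c1) * p c1)) * (scl a / scl c1)"
    using c1 parity_mirror[OF a] parity_mirror[OF c1] by (simp add: algebra_simps)
  then show ?thesis
    unfolding gtensor_sum_entry[OF finite_atLeastAtMost N] Let_def defs[symmetric] Emat_entry
    unfolding mult.assoc[of _ "of_int (th a)"] mult.assoc[of _ "of_int (th a) * of_int (th c1)"] sign_ratio[OF a c1] sgn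
    by (simp add: Q_fn_def)
qed


lemma R_infinity_entry:
  fixes r c :: "'i::{finite,linorder} \<times> 'i"
  assumes N: "CARD('i) = N"
  shows "(R_infinity N p th h :: ('a, 'i) end_VV) $ r $ c
    = R_infinity_fn (basis_no (fst r)) (basis_no (snd r)) (basis_no (fst c)) (basis_no (snd c))"
proof -
  define a b c1 d where "a = basis_no (fst r)" and "b = basis_no (snd r)"
    and "c1 = basis_no (fst c)" and "d = basis_no (snd c)"
  note defs = a_def b_def c1_def d_def
  have a: "a \<in> {1..N}" and c1: "c1 \<in> {1..N}"
    unfolding defs using basis_no_in N by metis+
  have mat: "(mat 1 :: ('a, 'i) end_VV) $ r $ c = of_bool (a = c1) * of_bool (b = d)"
    by (auto simp: mat_def defs prod_eq_iff)
  have half: "qpow h (- (of_int k :: rat) / 2) = h powi (- k)" for k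
    using qpow_half_int[of h "- k"] by simp
  have diag: "of_bool (a = c1) * of_bool (b = d) + (h - inverse h) * (of_bool (a = c1)
      * ((- 1) ^ p a * (- 1) ^ ((p b + p d) * p c1)
      * (h powi (nrm a) * of_bool (b = a \<and> d = a) - h powi (- nrm a) * of_bool (b = mir a \<and> d = mir a))))
    = of_bool (a = c1 \<and> b = d) * q powi (pairing c1 d)"
    using diag_entry[OF c1, of "inverse h" b d] h_nonzero
      h_powi_double[of "pairing c1 d"]
    by (cases "a = c1") (simp_all add: power_int_inverse power_int_minus)
  have q: "h\<^sup>2 - inverse (h\<^sup>2) = nu" by (simp add: nu_def q_def)
  show ?thesis
    unfolding R_infinity_def qpow_consts vector_add_component nth_map_matrix
      gtensor_diag_entry[OF N] gtensor_sum_entry[OF finite_atLeastLessThan N] Let_def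
      mat defs[symmetric] vector_minus_component Emat_entry wform_eps_eps[OF a] half qpow_half_int diag q
    using offdiag_entry[OF a c1, of b d] c1 by (auto simp: R_infinity_fn_def)
qed

lemma tau_entry:
  fixes r c :: "'i::{finite,linorder} \<times> 'i"
  shows "(tau p :: ('a, 'i) end_VV) $ r $ c
    = tau_fn (basis_no (fst r)) (basis_no (snd r)) (basis_no (fst c)) (basis_no (snd c))"
  by (simp add: tau_def tau_fn_def prod_eq_iff)

section \<open>Inverse and Baxterization\<close>

lemma tau_tau: "(tau p :: ('a, 'i::{finite,linorder}) end_VV) ** tau p = mat 1"
  by (simp add: vec_eq_iff tau_mult_entry) (auto simp: tau_def mat_def mult.commute simp flip: power_add)

lemma R_hat_VV_left_inverse:
  assumes N: "CARD('i::{finite,linorder}) = N"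
  shows "(tau p ** R_infinity N p th h :: ('a, 'i) end_VV) ** R_hat_VV N p th h = mat 1"
proof -
  have "((tau p ** R_infinity N p th h :: ('a, 'i) end_VV) ** R_hat_VV N p th h) $ r $ c = mat 1 $ r $ c"
    for r c :: "'i \<times> 'i"
  proof -
    define a b c1 d where "a = basis_no (fst r)" and "b = basis_no (snd r)"
      and "c1 = basis_no (fst c)" and "d = basis_no (snd c)"
    note defs = a_def b_def c1_def d_def
    have range: "a \<in> {1..N}" "b \<in> {1..N}" "c1 \<in> {1..N}" "d \<in> {1..N}"
      unfolding defs using basis_no_in N by metis+
    define f where "f x y = ((-1) ^ (p a * p b) * R_infinity_fn b a x y) * ((-1) ^ (p x * p y) * R_zero_fn y x c1 d)" for x y
    have "((tau p ** R_infinity N p th h :: ('a, 'i) end_VV) ** R_hat_VV N p th h) $ r $ c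
      = (\<Sum>k\<in>UNIV. (tau p ** R_infinity N p th h :: ('a, 'i) end_VV) $ r $ k * R_hat_VV N p th h $ k $ c)"
      by (simp add: matrix_matrix_mult_def)
    also have "\<dots> = (\<Sum>k\<in>(UNIV :: 'i set) \<times> (UNIV :: 'i set). f (basis_no (fst k)) (basis_no (snd k)))"
      unfolding R_hat_VV_def tau_mult_entry R_infinity_entry[OF N] R_zero_entry[OF N] f_def
      by (simp add: defs)
    also have "\<dots> = (\<Sum>x\<in>(UNIV :: 'i set). \<Sum>y\<in>(UNIV :: 'i set). f (basis_no x) (basis_no y))"
      by (simp add: sum.cartesian_product case_prod_unfold)
    also have "\<dots> = (\<Sum>x = 1..N. \<Sum>y = 1..N. f x y)"
      using sum_labels[of "\<lambda>x. \<Sum>y = 1..N. f x y", where 'i = 'i]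
      by (simp add: sum_labels N)
    also have "\<dots> = mat 1 $ r $ c"
      unfolding f_def R_hat_product_entries[OF range] by (auto simp: mat_def defs prod_eq_iff)
    finally show ?thesis .
  qed
  then show ?thesis by (simp add: vec_eq_iff)
qed

lemma matrix_inv_R_hat_VV:
  assumes N: "CARD('i::{finite,linorder}) = N"
  shows "invertible (R_hat_VV N p th h :: ('a, 'i) end_VV)"
    and "matrix_inv (R_hat_VV N p th h :: ('a, 'i) end_VV) = tau p ** R_infinity N p th h"
proof -
  note L = R_hat_VV_left_inverse[OF N]
  note R = L[THEN matrix_left_right_inverse[THEN iffD1]]
  show inv: "invertible (R_hat_VV N p th h :: ('a, 'i) end_VV)"
    using L invertible_left_inverse by blast
  show "matrix_inv (R_hat_VV N p th h :: ('a, 'i) end_VV) = tau p ** R_infinity N p th h"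
    by (rule matrix_inv_eqI[OF R L])
qed

text \<open>
  The elimination of \<open>\<tau> Q\<close> by the skein relation, multiplied by an arbitrary scalar \<open>l\<close>.
\<close>

lemma baxterization:
  fixes m n :: nat and x y z l c :: 'a
  defines "c \<equiv> qpow h (- of_nat m + of_nat n + 2)"
  assumes N: "CARD('i::{finite,linorder}) = N" "N = m + n" and z: "z \<noteq> 1"
    and x: "x = l * nu * (1 - c)" and y: "y = l * c"
  shows "(l * (z - 1)) \<odot> (R_hat m n p th h z :: ('a, 'i) end_VV)
    = (l * z * (z - 1)) \<odot> matrix_inv (R_hat_VV N p th h) + (x * z) \<odot> mat 1
      - (y * (z - 1)) \<odot> R_hat_VV N p th h"
proof -
  have "((l * (z - 1)) \<odot> (R_hat m n p th h z :: ('a, 'i) end_VV)) $ r $ s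
    = ((l * z * (z - 1)) \<odot> matrix_inv (R_hat_VV N p th h) + (x * z) \<odot> mat 1
      - (y * (z - 1)) \<odot> R_hat_VV N p th h) $ r $ s" for r s :: "'i \<times> 'i"
  proof -
    define a b c1 d where "a = basis_no (fst r)" and "b = basis_no (snd r)"
      and "c1 = basis_no (fst s)" and "d = basis_no (snd s)"
    note defs = a_def b_def c1_def d_def
    have range: "c1 \<in> {1..N}" "d \<in> {1..N}"
      unfolding defs using basis_no_in N(1) by metis+
    define \<sigma> :: 'a where "\<sigma> = (- 1) ^ (p a * p b)"
    have "(tau p ** tau p :: ('a, 'i) end_VV) $ r $ s = mat 1 $ r $ s"
      by (simp only: tau_tau)
    then have I: "mat 1 $ r $ s = \<sigma> * tau_fn b a c1 d"
      by (simp add: tau_mult_entry tau_entry \<sigma>_def defs)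
    have R0: "R_zero_fn b a c1 d = R_infinity_fn b a c1 d - nu * (tau_fn b a c1 d - Q_fn b a c1 d)"
      by (simp flip: skein_entries[OF range])
    have nu: "qpow h 1 - qpow h (- 1) = nu"
      by (simp add: qpow_consts nu_def q_def)
    have hat: "(R_hat m n p th h z :: ('a, 'i) end_VV) $ r $ s
       = \<sigma> * ((z - c) * R_infinity_fn b a c1 d + nu * ((z - c) / (z - 1)) * tau_fn b a c1 d - nu * c * Q_fn b a c1 d)"
      unfolding R_hat_def tau_mult_entry R_spec_def Let_def vector_add_component vector_minus_component
        nth_map_matrix c_def[symmetric] nu N(2)[symmetric] Q_entry[OF N(1)] R_infinity_entry[OF N(1)] tau_entry
      by (simp add: \<sigma>_def defs)
    have "(z - 1) * ((z - c) / (z - 1)) = z - c" using z by simp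
    then have "(l * (z - 1)) * (\<sigma> * ((z - c) * R_infinity_fn b a c1 d + nu * ((z - c) / (z - 1)) * tau_fn b a c1 d - nu * c * Q_fn b a c1 d))
      = l * z * (z - 1) * (\<sigma> * R_infinity_fn b a c1 d) + x * z * (\<sigma> * tau_fn b a c1 d) - y * (z - 1) * (\<sigma> * R_zero_fn b a c1 d)"
      unfolding R0 x y by algebra
    then show ?thesis
      unfolding vector_add_component vector_minus_component nth_map_matrix hat I matrix_inv_R_hat_VV(2)[OF N(1)]
      unfolding R_hat_VV_def tau_mult_entry R_infinity_entry[OF N(1)] R_zero_entry[OF N(1)]
      by (simp add: \<sigma>_def defs)
  qed
  then show ?thesis by (simp add: vec_eq_iff)
qed

end

theorem proposition6p8:
  fixes m n :: nat
    and p :: "nat \<Rightarrow> nat" and th :: "nat \<Rightarrow> int"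
    and q z l1 l2 l3 :: scalars_z
    and RVV Rz :: "(scalars_z, 'i::{finite,linorder}) end_VV"
  assumes "even n" and "m + n > 2" and "CARD('i) = m + n"
    and "\<And>i. i \<in> {1..m + n} \<Longrightarrow> p i \<in> {0, 1}"
    and "card {i \<in> {1..m + n}. p i = 0} = m"
    and "card {i \<in> {1..m + n}. p i = 1} = n"
    and "\<And>i. i \<in> {1..m + n} \<Longrightarrow> p (mirror (m + n) i) = p i"
    and "\<And>i. i \<in> {1..m + n} \<Longrightarrow> th i \<in> {1, -1}"
    and "\<And>i. i \<in> {1..m + n} \<Longrightarrow> p i = 0 \<Longrightarrow> th i = 1"
    and "\<And>i. i \<in> {1..m + n} \<Longrightarrow> p i = 1 \<Longrightarrow> th i = - th (mirror (m + n) i)"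
  defines "q \<equiv> sqrt_q ^ 2" and "z \<equiv> z_var"
    and "RVV \<equiv> R_hat_VV (m + n) p th sqrt_q"
    and "Rz \<equiv> R_hat m n p th sqrt_q z"
    and "l1 \<equiv> (- 1) ^ p 1 * q powi (- ((- 1) ^ p 1))"
    and "l2 \<equiv> - ((- 1) ^ p 1) * q powi ((- 1) ^ p 1)"
    and "l3 \<equiv> q powi (int m - int n - 1)"
  shows "invertible RVV \<and>
    (p 1 = 1 \<longrightarrow>
      (l1 * (z - 1)) \<odot> Rz =
        (l1 * z * (z - 1)) \<odot> matrix_inv RVV
        + ((1 + l1 / l2 + l1 / l3 + l1^2 / (l2 * l3)) * z) \<odot> mat 1
        - (l1 / (l2 * l3) * (z - 1)) \<odot> RVV) \<and>
    (p 1 = 0 \<longrightarrow>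
      (l1 * (z - 1)) \<odot> Rz =
        (l1 * z * (z - 1)) \<odot> matrix_inv RVV
        + ((1 + l1 / l2 + l1 / l3 + l2 / l3) * z) \<odot> mat 1
        - (1 / l3 * (z - 1)) \<odot> RVV)"
proof -
  have sqrt: "sqrt_q \<noteq> 0" by (simp add: sqrt_q_def)
  have z: "z \<noteq> 1"
  proof -
    have "[:0, 1 :: scalars:] \<noteq> 1" by (simp add: one_pCons)
    then have "to_fract [:0, 1 :: scalars:] \<noteq> to_fract 1" by (simp only: to_fract_eq_iff not_False_eq_True)
    then show ?thesis by (simp add: z_def z_var_def)
  qed
  interpret osp: osp_data "m + n" p th sqrt_q
    using assms(4,7-10) sqrt by unfold_locales
  have q: "osp.q = q" "q \<noteq> 0" using sqrt by (simp_all add: q_def osp.q_def)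
  define c where "c = qpow sqrt_q (- of_nat m + of_nat n + 2)"
  have "(- of_nat m + of_nat n + 2 :: rat) = of_int (2 * (int n - int m + 2)) / 2"
    by simp
  then have "c = q powi (int n - int m + 2)"
    unfolding c_def by (simp only: qpow_half_int osp.h_powi_double q)
  also have "int n - int m + 2 = 1 - (int m - int n - 1)" by simp
  finally have c: "c = q / l3"
    using q(2) power_int_diff[of q 1 "int m - int n - 1"] by (simp add: l3_def)
  have l3: "l3 \<noteq> 0" using q(2) by (simp add: l3_def)
  \<comment> \<open>For either parity \<open>\<nu> \<lambda>\<^sub>1 = 1 + \<lambda>\<^sub>1 / \<lambda>\<^sub>2\<close>.  The two displays differ because \<open>q\<close>, and with it \<open>c = q / \<lambda>\<^sub>3\<close>,
    is expressed by \<open>1 / \<lambda>\<^sub>2\<close> if \<open>v\<^sub>1\<close> is odd and by \<open>1 / \<lambda>\<^sub>1\<close> if it is even.\<close>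
  have nu: "osp.nu = q - inverse q" by (simp add: osp.nu_def q)
  note bax = osp.baxterization[OF assms(3) refl z, folded c_def]
  show ?thesis
  proof (intro conjI impI)
    show "invertible RVV" unfolding RVV_def by (rule osp.matrix_inv_R_hat_VV(1)[OF assms(3)])
  next
    assume "p 1 = 1"
    then have ll: "l1 = - q" "l2 = inverse q" by (simp_all add: l1_def l2_def power_int_minus)
    have "1 + l1 / l2 + l1 / l3 + l1^2 / (l2 * l3) = l1 * osp.nu * (1 - c)" "l1 / (l2 * l3) = l1 * c"
      using q(2) l3 by (simp_all add: ll c nu field_simps power2_eq_square)
    from bax[OF this] show "(l1 * (z - 1)) \<odot> Rz = (l1 * z * (z - 1)) \<odot> matrix_inv RVV
        + ((1 + l1 / l2 + l1 / l3 + l1^2 / (l2 * l3)) * z) \<odot> mat 1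
        - (l1 / (l2 * l3) * (z - 1)) \<odot> RVV"
      unfolding Rz_def RVV_def .
  next
    assume "p 1 = 0"
    then have ll: "l1 = inverse q" "l2 = - q" by (simp_all add: l1_def l2_def power_int_minus)
    have "1 + l1 / l2 + l1 / l3 + l2 / l3 = l1 * osp.nu * (1 - c)" "1 / l3 = l1 * c"
      using q(2) l3 by (simp_all add: ll c nu field_simps power2_eq_square)
    from bax[OF this] show "(l1 * (z - 1)) \<odot> Rz = (l1 * z * (z - 1)) \<odot> matrix_inv RVV
        + ((1 + l1 / l2 + l1 / l3 + l2 / l3) * z) \<odot> mat 1
        - (1 / l3 * (z - 1)) \<odot> RVV"
      unfolding Rz_def RVV_def .
  qed
qed

end
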